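(* Let $(A,\widetilde{A})$ be a dual pair of operators on a Hilbert space $\mathcal{H}$, where $A$ is dissipative, and let $\mathcal{D}(A)\cap\mathcal{D}(\widetilde{A})$ be dense in $\mathcal{H}$. Define $$A':=\overline{A\upharpoonright_{\mathcal{D}(A)\cap\mathcal{D}(\widetilde{A})}},\qquad \widetilde{A}':=\overline{\widetilde{A}\upharpoonright_{\mathcal{D}(A)\cap\mathcal{D}(\widetilde{A})}}.$$ Let $V_0'$ denote the operator $\frac{1}{2i}(A'-\widetilde{A}')$ with domain $\mathcal{D}(A)\cap\mathcal{D}(\widetilde{A})$ and let $V_K'$ be its Kreĭn–von Neumann extension. Let $\mathcal{V}\subset\mathcal{D}(\widetilde{A}'^* )//\mathcal{D}(A')$ be a subspace. Then the operator $A'_\mathcal{V}$ is a proper dissipative extension of the dual pair $(A,\widetilde{A})$ if and only if all of the following conditions are satisfied: \begin{itemize} \item $\mathcal{V}\subset\mathcal{D}({V_K'}^{1/2})$, \item $\operatorname{Im}\langle v,\widetilde{A}^*v\rangle\ge\|{V_K'}^{1/2}v\|^2$ for all $v\in\mathcal{V}$, \item $\mathcal{D}(A)\subset\mathcal{D}(A'_\mathcal{V})$, \item $\mathcal{V}\subset\mathcal{D}(\widetilde{A}^* )$. \end{itemize}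
   Context: The inner product $\langle\cdot,\cdot\rangle$ of the Hilbert space $\mathcal{H}$ is antilinear in the first and linear in the second argument. Dissipative: an operator $A$ is dissipative if it is densely defined and $\operatorname{Im}\langle f,Af\rangle\ge 0$ for all $f\in\mathcal{D}(A)$. Dual pair: a pair $(A,\widetilde{A})$ of densely defined closable operators with $A\subset\widetilde{A}^*$ (equivalently $\widetilde{A}\subset A^*$). A proper extension of $(A,\widetilde A)$ is an operator $B$ with $A\subset B\subset\widetilde{A}^*$. Complementary subspaces: for linear spaces $\mathcal{M}\subset\mathcal{N}$ (not necessarily closed), $\mathcal{N}//\mathcal{M}$ denotes any (fixed) subspace of $\mathcal{N}$ with $(\mathcal{N}//\mathcal{M})+\mathcal{M}=\mathcal{N}$ and $(\mathcal{N}//\mathcal{M})\cap\mathcal{M}=\{0\}$. For a subspace $\mathcal{V}\subset\mathcal{D}(\widetilde{A}'^* )//\mathcal{D}(A')$, the operator $A'_\mathcal{V}$ is defined by $\mathcal{D}(A'_\mathcal{V})=\mathcal{D}(A')\dot{+}\mathcal{V}$, $A'_\mathcal{V}=\widetilde{A}'^*\upharpoonright_{\mathcal{D}(A'_\mathcal{V})}$, where $\widetilde{A}'^*=(\widetilde{A}')^*$. Kreĭn–von Neumann extension: for a densely defined non-negative symmetric operator $V$, its Kreĭn–von Neumann extension $V_K$ is its smallest non-negative selfadjoint extension, i.e. $0\le V_K\le\widehat V$ for every non-negative selfadjoint extension $\widehat V$ of $V$ (it exists and is unique). Here, for non-negative selfadjoint $B,C$, $B\le C$ means $\mathcal{D}(B^{1/2})\supset\mathcal{D}(C^{1/2})$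 and $\|B^{1/2}f\|\le\|C^{1/2}f\|$ for all $f\in\mathcal{D}(C^{1/2})$. The operator $V_0'$ is non-negative and symmetric. *)

theory Defs
  imports "HOL-Analysis.Analysis"
begin

class complex_vector = real_vector +
  fixes scaleC :: "complex \<Rightarrow> 'a \<Rightarrow> 'a"  (infixr "*\<^sub>C" 75)
  assumes scaleC_add_right: "a *\<^sub>C (x + y) = a *\<^sub>C x + a *\<^sub>C y"
    and scaleC_add_left: "(a + b) *\<^sub>C x = a *\<^sub>C x + b *\<^sub>C x"
    and scaleC_scaleC: "a *\<^sub>C (b *\<^sub>C x) = (a * b) *\<^sub>C x"
    and scaleR_scaleC: "r *\<^sub>R x = complex_of_real r *\<^sub>C x"

class complex_inner = complex_vector + real_normed_vector +
  fixes cinner :: "'a \<Rightarrow> 'a \<Rightarrow> complex"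
  assumes cinner_commute: "cinner x y = cnj (cinner y x)"
    and cinner_add_right: "cinner x (y + z) = cinner x y + cinner x z"
    and cinner_scaleC_right: "cinner x (a *\<^sub>C y) = a * cinner x y"
    and cinner_self: "cinner x x = complex_of_real ((norm x)\<^sup>2)"

class chilbert_space = complex_inner + complete_space

instantiation complex :: chilbert_space
begin

definition "scaleC_complex = ((*) :: complex \<Rightarrow> _)"
definition "cinner_complex x y = cnj x * (y :: complex)"

instance
proof
  fix x y z a b :: complex and r :: real
  show "a *\<^sub>C (x + y) = a *\<^sub>C x + a *\<^sub>C y" "(a + b) *\<^sub>C x = a *\<^sub>C x + b *\<^sub>C x"
    "a *\<^sub>C (b *\<^sub>C x) = (a * b) *\<^sub>C x"
    by (simp_all add: scaleC_complex_def distrib_left distrib_right)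
  show "r *\<^sub>R x = complex_of_real r *\<^sub>C x"
    by (simp add: scaleC_complex_def scaleR_conv_of_real)
  show "cinner x y = cnj (cinner y x)"
    by (simp add: cinner_complex_def mult.commute)
  show "cinner x (y + z) = cinner x y + cinner x z"
    by (simp add: cinner_complex_def distrib_left)
  show "cinner x (a *\<^sub>C y) = a * cinner x y"
    by (simp add: cinner_complex_def scaleC_complex_def mult.left_commute)
  show "cinner x x = complex_of_real ((norm x)\<^sup>2)"
    unfolding cinner_complex_def by (metis complex_norm_square mult.commute)
qed

end

definition csubspace :: "'a::complex_vector set \<Rightarrow> bool" where
  "csubspace S \<longleftrightarrow> 0 \<in> S \<and> (\<forall>x\<in>S. \<forall>y\<in>S. x + y \<in> S) \<and> (\<forall>c. \<forall>x\<in>S. c *\<^sub>C x \<in> S)"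

text \<open>
  \<open>complementary W M N\<close>: the subspace \<open>W\<close> is a possible choice of \<open>N//M\<close>, for subspaces \<open>M \<subseteq> N\<close>
  that need not be closed.
\<close>

definition complementary :: "'a::complex_vector set \<Rightarrow> 'a set \<Rightarrow> 'a set \<Rightarrow> bool" where
  "complementary W M N \<longleftrightarrow>
     csubspace W \<and> W \<subseteq> N \<and> {w + m | w m. w \<in> W \<and> m \<in> M} = N \<and> W \<inter> M = {0}"

text \<open>
  An unbounded operator is represented by its graph. Thus its domain is \<^const>\<open>Domain\<close>, \<open>S\<close> is a
  restriction of \<open>T\<close> iff \<open>S \<subseteq> T\<close>, the closure of an operator is the topological closure of its
  graph, and the square of \<open>S\<close>, with its natural domain, is \<open>S O S\<close>.
\<close>

type_synonym 'a lop = "('a \<times> 'a) set"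

definition linear_op :: "'a::complex_vector lop \<Rightarrow> bool" where
  "linear_op T \<longleftrightarrow> single_valued T \<and> (0, 0) \<in> T \<and>
     (\<forall>(f, g)\<in>T. \<forall>(f', g')\<in>T. (f + f', g + g') \<in> T) \<and>
     (\<forall>c. \<forall>(f, g)\<in>T. (c *\<^sub>C f, c *\<^sub>C g) \<in> T)"

text \<open>Only meaningful for \<open>x \<in> Domain T\<close>.\<close>

definition op_app :: "'a lop \<Rightarrow> 'a \<Rightarrow> 'a"  (infixl "\<cdot>\<^sub>o" 80) where
  "T \<cdot>\<^sub>o x = (THE y. (x, y) \<in> T)"

definition op_restrict :: "'a lop \<Rightarrow> 'a set \<Rightarrow> 'a lop" where
  "op_restrict T D = {(f, g) \<in> T. f \<in> D}"

definition op_diff :: "'a::complex_vector lop \<Rightarrow> 'a lop \<Rightarrow> 'a lop" where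
  "op_diff S T = {(f, g - h) | f g h. (f, g) \<in> S \<and> (f, h) \<in> T}"

definition op_scale :: "complex \<Rightarrow> 'a::complex_vector lop \<Rightarrow> 'a lop" where
  "op_scale c T = {(f, c *\<^sub>C g) | f g. (f, g) \<in> T}"

definition densely_defined :: "'a::complex_inner lop \<Rightarrow> bool" where
  "densely_defined T \<longleftrightarrow> closure (Domain T) = UNIV"

definition closable :: "'a::complex_inner lop \<Rightarrow> bool" where
  "closable T \<longleftrightarrow> single_valued (closure T)"

definition adjoint_op :: "'a::complex_inner lop \<Rightarrow> 'a lop" where
  "adjoint_op T = {(g, h). \<forall>(f, k)\<in>T. cinner g k = cinner h f}"

definition dissipative :: "'a::complex_inner lop \<Rightarrow> bool" where
  "dissipative T \<longleftrightarrow> linear_op T \<and> densely_defined T \<and>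
     (\<forall>f\<in>Domain T. 0 \<le> Im (cinner f (T \<cdot>\<^sub>o f)))"

definition dual_pair :: "'a::complex_inner lop \<Rightarrow> 'a lop \<Rightarrow> bool" where
  "dual_pair A B \<longleftrightarrow>
     linear_op A \<and> densely_defined A \<and> closable A \<and>
     linear_op B \<and> densely_defined B \<and> closable B \<and>
     A \<subseteq> adjoint_op B"

definition proper_extension :: "'a::complex_inner lop \<Rightarrow> 'a lop \<Rightarrow> 'a lop \<Rightarrow> bool" where
  "proper_extension A B C \<longleftrightarrow> linear_op C \<and> A \<subseteq> C \<and> C \<subseteq> adjoint_op B"

definition selfadjoint :: "'a::complex_inner lop \<Rightarrow> bool" where
  "selfadjoint T \<longleftrightarrow> linear_op T \<and> densely_defined T \<and> adjoint_op T = T"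

definition nonneg_op :: "'a::complex_inner lop \<Rightarrow> bool" where
  "nonneg_op T \<longleftrightarrow>
     (\<forall>f\<in>Domain T. Im (cinner f (T \<cdot>\<^sub>o f)) = 0 \<and> 0 \<le> Re (cinner f (T \<cdot>\<^sub>o f)))"

text \<open>The unique non-negative selfadjoint square root of a non-negative selfadjoint operator.\<close>

definition sqrt_op :: "'a::chilbert_space lop \<Rightarrow> 'a lop" where
  "sqrt_op B = (THE S. selfadjoint S \<and> nonneg_op S \<and> S O S = B)"

definition op_le :: "'a::chilbert_space lop \<Rightarrow> 'a lop \<Rightarrow> bool" where
  "op_le B C \<longleftrightarrow> Domain (sqrt_op C) \<subseteq> Domain (sqrt_op B) \<and>
     (\<forall>f\<in>Domain (sqrt_op C). norm (sqrt_op B \<cdot>\<^sub>o f) \<le> norm (sqrt_op C \<cdot>\<^sub>o f))"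

definition nonneg_selfadjoint_extension :: "'a::complex_inner lop \<Rightarrow> 'a lop \<Rightarrow> bool" where
  "nonneg_selfadjoint_extension V B \<longleftrightarrow> selfadjoint B \<and> nonneg_op B \<and> V \<subseteq> B"

text \<open>The Krein--von Neumann extension: the smallest non-negative selfadjoint extension.\<close>

definition krein_extension :: "'a::chilbert_space lop \<Rightarrow> 'a lop" where
  "krein_extension V =
     (THE K. nonneg_selfadjoint_extension V K \<and>
        (\<forall>B. nonneg_selfadjoint_extension V B \<longrightarrow> op_le K B))"

text \<open>
  The operator \<open>A\<^sub>\<V>\<close> attached to a pair \<open>(A, B)\<close>: the restriction of the adjoint of \<open>B\<close> to the sum of
  the domain of \<open>A\<close> and \<open>\<V>\<close>.
\<close>

definition extension_by :: "'a::complex_inner lop \<Rightarrow> 'a lop \<Rightarrow> 'a set \<Rightarrow> 'a lop" where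
  "extension_by A B \<V> = op_restrict (adjoint_op B) {f + v | f v. f \<in> Domain A \<and> v \<in> \<V>}"

end

(*
  Write T for the adjoint of At'. For f in D(A) \<inter> D(At) and v in D(T), the imaginary part of
  \<langle>f + v, T (f + v)\<rangle> equals \<langle>f, V0' f\<rangle> + 2 Re \<langle>V0' f, v\<rangle> + Im \<langle>v, T v\<rangle>. It is nonnegative for all f iff
  Im \<langle>v, T v\<rangle> is at least sup_f (- \<langle>f, V0' f\<rangle> - 2 Re \<langle>V0' f, v\<rangle>), which by a theorem of Ando and
  Nishio is the form of the Krein-von Neumann extension of V0' at v.

  That theorem is proved directly. The supremum q is a closed quadratic form, and the parallelogram
  law makes the minimiser R x of h \<mapsto> q h + |h - x|^2 unique and linear in x; the operator K with
  (1 + K)^(-1) = R is selfadjoint, extends V0', and every other nonnegative selfadjoint extension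
  has a larger form. The square root of B comes from R = (1 + B)^(-1) as the graph of all
  (C x, Z x), where C = R^(1/2) and Z = (1 - R)^(1/2); these bounded square roots are norm limits of
  the iteration Y \<mapsto> (X + Y^2) / 2.
*)

theory Submission
  imports Defs
begin

section \<open>Complex inner product spaces\<close>

\<comment> \<open>Every element of the extended domain is f + v with f in D(A'), so dissipativity
  can be tested on one coset v + D(A') at a time, and on each coset it is a bound on a supremum.
  That supremum may be infinite, which is why the argument speaks of upper bounds c rather than of
  its value. The obstacle is that \<open>sqrt_op\<close> and \<open>krein_extension\<close> are
  definite descriptions: nothing is known of either before unique existence is shown. An arbitrary
  competing root S' of B is unbounded; it is compared with the constructed one through the bounded
  operator S' R. Uniqueness of the Krein extension rests on antisymmetry of the form order, that is,
  on recovering an operator from the norms of its root. No spectral calculus is used. An unbounded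
  operator enters as the graph of all (R x, x - R x), with R and 1 - R contractions, and positivity
  of a bounded root C is carried by a norm bound on 1 - C. The form of K is reached from two sides:
  completing the square gives one inequality for every extension B, and regularising with (1 +
  \<epsilon> K)^(-1) gives the converse for K itself.\<close>
subclass (in chilbert_space) banach ..

lemma cinner_add_left: "cinner (x + y) z = cinner x z + cinner (y::'a::complex_inner) z"
  by (metis cinner_add_right cinner_commute complex_cnj_add)

lemma cinner_zero_right [simp]: "cinner x (0::'a::complex_inner) = 0"
  using cinner_add_right[of x 0 0] by simp

lemma cinner_zero_left [simp]: "cinner (0::'a::complex_inner) x = 0"
  using cinner_add_left[of 0 0 x] by simp

lemma cinner_minus_right [simp]: "cinner x (- y) = - cinner x (y::'a::complex_inner)"
  using cinner_add_right[of x y "- y"] by (simp add: add_eq_0_iff)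

lemma cinner_minus_left [simp]: "cinner (- x) y = - cinner x (y::'a::complex_inner)"
  using cinner_add_left[of x "- x" y] by (simp add: add_eq_0_iff)

lemma cinner_diff_right: "cinner x (y - z) = cinner x y - cinner x (z::'a::complex_inner)"
  using cinner_add_right[of x y "- z"] by simp

lemma cinner_diff_left: "cinner (x - y) z = cinner x z - cinner (y::'a::complex_inner) z"
  using cinner_add_left[of x "- y" z] by simp

lemma cinner_scaleC_left: "cinner (a *\<^sub>C x) y = cnj a * cinner x (y::'a::complex_inner)"
  by (metis cinner_commute cinner_scaleC_right complex_cnj_mult)

lemma cinner_scaleR_left: "cinner (r *\<^sub>R x) y = of_real r * cinner x (y::'a::complex_inner)"
  by (simp add: scaleR_scaleC cinner_scaleC_left)

lemma cinner_scaleR_right: "cinner x (r *\<^sub>R y) = of_real r * cinner x (y::'a::complex_inner)"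
  by (simp add: scaleR_scaleC cinner_scaleC_right)

lemmas cinner_simps = cinner_add_left cinner_add_right cinner_diff_left cinner_diff_right
  cinner_scaleC_left cinner_scaleC_right cinner_scaleR_left cinner_scaleR_right

lemma scaleC_one [simp]: "1 *\<^sub>C x = (x::'a::complex_vector)"
  by (metis of_real_1 scaleR_one scaleR_scaleC)

lemma scaleC_zero_left [simp]: "0 *\<^sub>C x = (0::'a::complex_vector)"
  by (metis of_real_0 scaleR_zero_left scaleR_scaleC)

lemma scaleC_zero_right [simp]: "a *\<^sub>C 0 = (0::'a::complex_vector)"
  using scaleC_add_right[of a 0 "0::'a"] by simp

lemma scaleC_minus_right: "a *\<^sub>C (- x) = - (a *\<^sub>C (x::'a::complex_vector))"
  using scaleC_add_right[of a x "- x"] by (simp add: add_eq_0_iff)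

lemma scaleC_diff_right: "a *\<^sub>C (x - y) = a *\<^sub>C x - a *\<^sub>C (y::'a::complex_vector)"
  using scaleC_add_right[of a x "- y"] by (simp add: scaleC_minus_right)

lemma Re_cinner_commute: "Re (cinner x y) = Re (cinner y (x::'a::complex_inner))"
  using cinner_commute[of x y] by (metis cnj.sel(1))

lemma Im_cinner_commute: "Im (cinner x y) = - Im (cinner y (x::'a::complex_inner))"
  using cinner_commute[of x y] by (metis cnj.sel(2))

lemma norm_add_sq:
  "(norm (x + y))\<^sup>2 = (norm x)\<^sup>2 + 2 * Re (cinner x y) + (norm (y::'a::complex_inner))\<^sup>2"
proof -
  have "(norm (x + y))\<^sup>2 = Re (cinner (x + y) (x + y))" by (simp add: cinner_self)
  also have "\<dots> = Re (cinner x x) + Re (cinner y y) + Re (cinner x y) + Re (cinner y x)"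
    by (simp add: cinner_add_left cinner_add_right)
  also have "\<dots> = (norm x)\<^sup>2 + (norm y)\<^sup>2 + Re (cinner x y) + Re (cinner x y)"
    unfolding Re_cinner_commute[of y x] cinner_self by simp
  finally show ?thesis by simp
qed

lemma norm_diff_sq:
  "(norm (x - y))\<^sup>2 = (norm x)\<^sup>2 - 2 * Re (cinner x y) + (norm (y::'a::complex_inner))\<^sup>2"
  using norm_add_sq[of x "- y"] by simp

lemma norm_scaleC: "norm (c *\<^sub>C x) = cmod c * norm (x::'a::complex_inner)"
proof -
  have "complex_of_real ((norm (c *\<^sub>C x))\<^sup>2) = cnj c * c * cinner x x"
    by (simp only: cinner_self[symmetric] cinner_simps) simp
  also have "\<dots> = complex_of_real ((cmod c * norm x)\<^sup>2)"
    by (simp only: cinner_self power_mult_distrib of_real_mult complex_norm_square) simp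
  finally have "(norm (c *\<^sub>C x))\<^sup>2 = (cmod c * norm x)\<^sup>2" by (simp only: of_real_eq_iff)
  then show ?thesis by simp
qed

lemma cinner_eq_zero_iff [simp]: "cinner x x = 0 \<longleftrightarrow> x = (0::'a::complex_inner)"
  by (simp add: cinner_self)

lemma Re_cinner_le: "Re (cinner x y) \<le> norm x * norm (y::'a::complex_inner)"
proof (cases "x = 0 \<or> y = 0")
  case False
  let ?a = "norm x" and ?b = "norm y"
  have "0 \<le> (norm (?b *\<^sub>R x - ?a *\<^sub>R y))\<^sup>2" by simp
  also have "\<dots> = 2 * ?a * ?b * (?a * ?b - Re (cinner x y))"
    unfolding norm_diff_sq by (simp add: cinner_simps power2_eq_square algebra_simps)
  finally have "0 \<le> 2 * ?a * ?b * (?a * ?b - Re (cinner x y))" .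
  moreover have "0 < 2 * ?a * ?b" using False by simp
  ultimately show ?thesis by (metis diff_ge_0_iff_ge zero_le_mult_iff not_less)
qed auto

text \<open>Rotating \<open>y\<close> by the unimodular \<open>s\<close> makes the inner product
  real and nonnegative, which reduces the bound to \<open>Re_cinner_le\<close>.\<close>

lemma cmod_cinner_le: "cmod (cinner x y) \<le> norm x * norm (y::'a::complex_inner)"
proof (cases "cinner x y = 0")
  case False
  define s where "s = cnj (sgn (cinner x y))"
  have s: "cmod s = 1" using False by (simp add: s_def norm_sgn)
  have "s * cinner x y = cmod (cinner x y)"
    using False by (simp add: s_def sgn_eq divide_simps complex_norm_square[symmetric] mult.commute)
      (simp add: power2_eq_square)
  then have "cmod (cinner x y) = Re (cinner x (s *\<^sub>C y))" by (simp add: cinner_scaleC_right)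
  also have "\<dots> \<le> norm x * norm y"
    using Re_cinner_le[of x "s *\<^sub>C y"] s by (simp add: norm_scaleC)
  finally show ?thesis .
qed simp

lemma bounded_bilinear_cinner: "bounded_bilinear (cinner :: 'a::complex_inner \<Rightarrow> 'a \<Rightarrow> complex)"
proof
  show "\<exists>K. \<forall>a b::'a. cmod (cinner a b) \<le> norm a * norm b * K"
    by (rule exI[of _ 1]) (simp add: cmod_cinner_le)
qed (simp_all add: cinner_simps scaleR_conv_of_real)

lemmas tendsto_cinner [tendsto_intros] = bounded_bilinear.tendsto[OF bounded_bilinear_cinner]

lemma bounded_linear_scaleC: "bounded_linear (\<lambda>x::'a::complex_inner. c *\<^sub>C x)"
proof
  show "c *\<^sub>C (r *\<^sub>R x) = r *\<^sub>R c *\<^sub>C x" for r and x :: 'a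
    by (simp add: scaleR_scaleC scaleC_scaleC mult.commute)
  show "\<exists>K. \<forall>x::'a. norm (c *\<^sub>C x) \<le> norm x * K"
    by (rule exI[of _ "cmod c"]) (simp add: norm_scaleC)
qed (simp add: scaleC_add_right)

lemmas tendsto_scaleC [tendsto_intros] = bounded_linear.tendsto[OF bounded_linear_scaleC]

lemma eq_if_cinner_eq: "(\<And>z. cinner z x = cinner z y) \<Longrightarrow> x = (y::'a::complex_inner)"
  using cinner_eq_zero_iff[of "x - y"] cinner_diff_right[of "x - y" x y] by simp

lemma eq_if_cinner_dense_eq:
  assumes "closure D = UNIV" and "\<And>z. z \<in> D \<Longrightarrow> cinner z x = cinner z y"
  shows "x = (y::'a::complex_inner)"
proof (rule eq_if_cinner_eq)
  fix z
  have "z \<in> closure D" using assms(1) by simp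
  then obtain s where s: "\<And>n. s n \<in> D" "s \<longlonglongrightarrow> z" unfolding closure_sequential by blast
  have "(\<lambda>n. cinner (s n) x) \<longlonglongrightarrow> cinner z x" "(\<lambda>n. cinner (s n) y) \<longlonglongrightarrow> cinner z y"
    by (intro tendsto_intros s)+
  then show "cinner z x = cinner z y" using assms(2)[OF s(1)] LIMSEQ_unique by fastforce
qed

lemma csubspaceD:
  assumes "csubspace S"
  shows "0 \<in> S" "\<And>x y. x \<in> S \<Longrightarrow> y \<in> S \<Longrightarrow> x + y \<in> S" "\<And>c x. x \<in> S \<Longrightarrow> c *\<^sub>C x \<in> S"
    "\<And>r x. x \<in> S \<Longrightarrow> r *\<^sub>R x \<in> S" "\<And>x y. x \<in> S \<Longrightarrow> y \<in> S \<Longrightarrow> x - y \<in> S"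
proof -
  show *: "0 \<in> S" "\<And>x y. x \<in> S \<Longrightarrow> y \<in> S \<Longrightarrow> x + y \<in> S" "\<And>c x. x \<in> S \<Longrightarrow> c *\<^sub>C x \<in> S"
    using assms by (auto simp: csubspace_def)
  then show "\<And>r x. x \<in> S \<Longrightarrow> r *\<^sub>R x \<in> S" by (simp add: scaleR_scaleC)
  then have "\<And>x. x \<in> S \<Longrightarrow> - x \<in> S" by (metis scaleR_minus1_left)
  then show "\<And>x y. x \<in> S \<Longrightarrow> y \<in> S \<Longrightarrow> x - y \<in> S" using *(2) by (metis diff_conv_add_uminus)
qed

lemma csubspace_closure:
  assumes "csubspace (S :: 'a::complex_inner set)"
  shows "csubspace (closure S)"
  unfolding csubspace_def
proof (intro conjI ballI allI)
  note S = csubspaceD[OF assms]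
  show "0 \<in> closure S" using S(1) closure_subset by blast
  fix x assume x: "x \<in> closure S"
  then obtain s where s: "\<And>n. s n \<in> S" "s \<longlonglongrightarrow> x" unfolding closure_sequential by blast
  show "c *\<^sub>C x \<in> closure S" for c
    unfolding closure_sequential
    by (rule exI[of _ "\<lambda>n. c *\<^sub>C s n"]) (auto intro!: tendsto_intros s S)
  fix y assume "y \<in> closure S"
  then obtain t where t: "\<And>n. t n \<in> S" "t \<longlonglongrightarrow> y" unfolding closure_sequential by blast
  show "x + y \<in> closure S"
    unfolding closure_sequential
    by (rule exI[of _ "\<lambda>n. s n + t n"]) (auto intro!: tendsto_intros s t S)
qed

text \<open>Graphs are subsets of the product, so with this inner product subspace, closure and
  projection arguments apply to them directly.\<close>

instantiation prod :: (complex_inner, complex_inner) complex_inner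
begin

definition "scaleC_prod c (x :: 'a \<times> 'b) = (c *\<^sub>C fst x, c *\<^sub>C snd x)"
definition "cinner_prod (x :: 'a \<times> 'b) y = cinner (fst x) (fst y) + cinner (snd x) (snd y)"

instance
proof
  fix x y z :: "'a \<times> 'b" and a b :: complex and r :: real
  show "a *\<^sub>C (x + y) = a *\<^sub>C x + a *\<^sub>C y" "(a + b) *\<^sub>C x = a *\<^sub>C x + b *\<^sub>C x"
    "a *\<^sub>C (b *\<^sub>C x) = (a * b) *\<^sub>C x"
    by (simp_all add: scaleC_prod_def scaleC_add_right scaleC_add_left scaleC_scaleC)
  show "r *\<^sub>R x = complex_of_real r *\<^sub>C x"
    by (simp add: scaleC_prod_def scaleR_scaleC[symmetric] scaleR_prod_def)
  show "cinner x y = cnj (cinner y x)"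
    by (simp add: cinner_prod_def cinner_commute[symmetric])
  show "cinner x (y + z) = cinner x y + cinner x z"
    by (simp add: cinner_prod_def cinner_add_right)
  show "cinner x (a *\<^sub>C y) = a * cinner x y"
    by (simp add: cinner_prod_def scaleC_prod_def cinner_scaleC_right distrib_left)
  show "cinner x x = complex_of_real ((norm x)\<^sup>2)"
    by (simp add: cinner_prod_def norm_prod_def cinner_self)
qed

end

instance prod :: (chilbert_space, chilbert_space) chilbert_space ..

section \<open>Closed quadratic forms\<close>

text \<open>A vanishing first variation: divide by \<open>t\<close> and let \<open>t\<close> tend to
  0 from both sides. It is used on quadratic inequalities expanded around an extremal point.\<close>

lemma quadratic_bound_zero:
  fixes a b :: real
  assumes "\<And>t. t * b \<le> t\<^sup>2 * a"
  shows "b = 0"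
proof (rule ccontr)
  assume "b \<noteq> 0"
  \<comment> \<open>Any positive \<open>k\<close> above \<open>a\<close> would do: at
    \<open>t = b / k\<close> the hypothesis becomes \<open>1 <= a / k\<close> after cancelling
    \<open>b^2 / k\<close>.\<close>
  define k where "k = \<bar>a\<bar> + 1"
  have k: "0 < k" "a < k" unfolding k_def by auto
  have "b\<^sup>2 / k \<le> (b\<^sup>2 / k) * (a / k)" using assms[of "b / k"] by (simp add: power2_eq_square)
  moreover have "0 < b\<^sup>2 / k" using \<open>b \<noteq> 0\<close> k by simp
  ultimately have "1 \<le> a / k" using mult_less_cancel_left2[of "b\<^sup>2 / k" "a / k"] by linarith
  then show False using k by simp
qed

text \<open>Only diagonal values are given, no sesquilinear form. The one-sided parallelogram law
  contains the reverse one: apply it to \<open>x + y\<close> and \<open>x - y\<close> and use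
  homogeneity. Closedness of the form is stated as closedness of its sublevel sets.\<close>

locale closed_form =
  fixes Q :: "'a::chilbert_space set" and q :: "'a \<Rightarrow> real"
  assumes csubspace: "csubspace Q"
    and nonneg: "x \<in> Q \<Longrightarrow> 0 \<le> q x"
    and scale: "x \<in> Q \<Longrightarrow> q (a *\<^sub>C x) = (cmod a)\<^sup>2 * q x"
    and parallelogram: "x \<in> Q \<Longrightarrow> y \<in> Q \<Longrightarrow> q (x + y) + q (x - y) \<le> 2 * q x + 2 * q y"
    and lsc: "(\<And>n. h n \<in> Q) \<Longrightarrow> h \<longlonglongrightarrow> x \<Longrightarrow> (\<And>n. q (h n) \<le> c) \<Longrightarrow> x \<in> Q \<and> q x \<le> c"
begin

lemmas Q = csubspaceD[OF csubspace]

lemma scaleR: "x \<in> Q \<Longrightarrow> q (r *\<^sub>R x) = r\<^sup>2 * q x"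
  using scale[of x "of_real r"] by (simp add: scaleR_scaleC)

definition energy where "energy u x = q u + (norm (u - x))\<^sup>2"

lemma energy_nonneg: "u \<in> Q \<Longrightarrow> 0 \<le> energy u x"
  by (simp add: energy_def nonneg)

lemma energy_scale: "u \<in> Q \<Longrightarrow> energy (c *\<^sub>C u) (c *\<^sub>C x) = (cmod c)\<^sup>2 * energy u x"
  using scale[of u c]
  by (simp add: energy_def scaleC_diff_right[symmetric] norm_scaleC power_mult_distrib distrib_left)

text \<open>The energy is a quadratic form in the pair of its arguments. Using the law jointly in
  both is what makes the minimiser additive in \<open>x\<close>.\<close>

lemma energy_parallelogram:
  assumes "u \<in> Q" "v \<in> Q"
  shows "energy (u + v) (x + y) + energy (u - v) (x - y) \<le> 2 * energy u x + 2 * energy v y"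
proof -
  have eq: "u + v - (x + y) = (u - x) + (v - y)" "u - v - (x - y) = (u - x) - (v - y)" by auto
  show ?thesis
    unfolding energy_def eq norm_add_sq[of "u - x" "v - y"] norm_diff_sq[of "u - x" "v - y"]
      ring_distribs
    using parallelogram[OF assms] by linarith
qed

definition minimiser where "minimiser x u \<longleftrightarrow> u \<in> Q \<and> (\<forall>h\<in>Q. energy u x \<le> energy h x)"

text \<open>Uniform convexity: the midpoint of two near-minimisers cannot fall below
  \<open>m\<close>, so their difference has to be small. This gives uniqueness as well as the Cauchy
  property of minimising sequences.\<close>

lemma energy_midpoint:
  assumes "u \<in> Q" "v \<in> Q" and m: "\<And>h. h \<in> Q \<Longrightarrow> m \<le> energy h x"
  shows "(norm (u - v))\<^sup>2 \<le> 2 * (energy u x - m) + 2 * (energy v x - m)"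
proof -
  have "2 *\<^sub>C z = z + z" for z :: 'a using scaleC_add_left[of 1 1 z] by simp
  then have "energy (u + v) (x + x) = energy (2 *\<^sub>C (1/2) *\<^sub>R (u + v)) (2 *\<^sub>C x)"
    by (simp add: scaleR_scaleC scaleC_scaleC)
  also have "\<dots> = 4 * energy ((1/2) *\<^sub>R (u + v)) x"
    using assms energy_scale[of "(1/2) *\<^sub>R (u + v)" 2 x] by (simp add: Q)
  finally have "energy (u + v) (x + x) = 4 * energy ((1/2) *\<^sub>R (u + v)) x" .
  moreover have "m \<le> energy ((1/2) *\<^sub>R (u + v)) x" using assms by (intro m Q)
  moreover have "(norm (u - v))\<^sup>2 \<le> energy (u - v) (x - x)"
    using nonneg[OF Q(5)[OF assms(1,2)]] by (simp add: energy_def)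
  ultimately show ?thesis
    using energy_parallelogram[OF assms(1,2), of x x] unfolding right_diff_distrib by linarith
qed

lemma minimiser_unique:
  assumes "minimiser x u" "u' \<in> Q" "energy u' x \<le> energy u x"
  shows "u' = u"
proof -
  have "(norm (u' - u))\<^sup>2 \<le> 2 * (energy u' x - energy u x) + 2 * (energy u x - energy u x)"
    using assms unfolding minimiser_def by (intro energy_midpoint) auto
  then have "(norm (u' - u))\<^sup>2 \<le> 0" using assms(3) unfolding right_diff_distrib by linarith
  then show ?thesis by simp
qed

lemma minimiser_exists: "\<exists>u. minimiser x u"
proof -
  define m where "m = (INF h\<in>Q. energy h x)"
  have bdd: "bdd_below ((\<lambda>h. energy h x) ` Q)" using energy_nonneg by (intro bdd_belowI[of _ 0]) auto
  have m: "m \<le> energy h x" if "h \<in> Q" for h using bdd that unfolding m_def by (rule cINF_lower)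
  define r where "r n = inverse (real (Suc n))" for n
  have r: "0 < r n" "r \<longlonglongrightarrow> 0" "N \<le> n \<Longrightarrow> r n \<le> r N" for n N
    unfolding r_def using LIMSEQ_inverse_real_of_nat by (simp_all add: divide_simps)
  have "\<exists>h\<in>Q. energy h x < m + r n" for n
    using cINF_less_iff[OF _ bdd, of "m + r n"] Q(1) r(1)[of n] unfolding m_def by force
  then obtain h where h: "\<And>n. h n \<in> Q" "\<And>n. energy (h n) x < m + r n" by metis
  have dist: "(norm (h i - h j))\<^sup>2 \<le> 4 * r N" if "N \<le> i" "N \<le> j" for N i j
  proof -
    have "(norm (h i - h j))\<^sup>2 \<le> 2 * (energy (h i) x - m) + 2 * (energy (h j) x - m)"
      by (rule energy_midpoint) (auto intro: h m)
    then show ?thesis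
      using h(2)[of i] h(2)[of j] r(3)[OF that(1)] r(3)[OF that(2)]
      unfolding right_diff_distrib by linarith
  qed
  have "Cauchy h"
  proof (rule metric_CauchyI)
    fix e :: real assume e: "0 < e"
    then obtain N where N: "r N < e\<^sup>2 / 4"
      using reals_Archimedean[of "e\<^sup>2 / 4"] unfolding r_def by auto
    show "\<exists>M. \<forall>i\<ge>M. \<forall>j\<ge>M. dist (h i) (h j) < e"
    proof (intro exI[of _ N] allI impI)
      fix i j assume "N \<le> i" "N \<le> j"
      then have "(norm (h i - h j))\<^sup>2 < e\<^sup>2" using dist[of N i j] N by linarith
      then show "dist (h i) (h j) < e" using e by (simp add: dist_norm power_less_imp_less_base)
    qed
  qed
  then obtain u where u: "h \<longlonglongrightarrow> u" using Cauchy_convergent convergent_def by blast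
  have lim: "(\<lambda>n. m + r n - (norm (h n - x))\<^sup>2) \<longlonglongrightarrow> m + 0 - (norm (u - x))\<^sup>2"
    by (intro tendsto_intros u r)
  \<comment> \<open>\<open>lsc\<close> asks for one bound along the whole sequence, hence the
    passage to a tail and the slack \<open>e\<close>, which \<open>le\<close> removes.\<close>
  have key: "u \<in> Q \<and> q u \<le> m - (norm (u - x))\<^sup>2 + e" if "0 < e" for e
  proof -
    have "\<forall>\<^sub>F n in sequentially. m + r n - (norm (h n - x))\<^sup>2 < m - (norm (u - x))\<^sup>2 + e"
      using order_tendstoD(2)[OF lim, of "m - (norm (u - x))\<^sup>2 + e"] that by simp
    then obtain N where N: "\<And>n. N \<le> n \<Longrightarrow>
        m + r n - (norm (h n - x))\<^sup>2 < m - (norm (u - x))\<^sup>2 + e"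
      unfolding eventually_sequentially by blast
    show ?thesis
    proof (rule lsc[of "\<lambda>n. h (n + N)"])
      show "q (h (n + N)) \<le> m - (norm (u - x))\<^sup>2 + e" for n
        using N[of "n + N"] h(2)[of "n + N"] unfolding energy_def by simp
    qed (auto intro: h LIMSEQ_ignore_initial_segment u)
  qed
  have le: "energy u x \<le> m"
  proof (rule field_le_epsilon)
    show "energy u x \<le> m + e" if "0 < e" for e using key[OF that] unfolding energy_def by linarith
  qed
  have "u \<in> Q" using key[of 1] by simp
  moreover have "energy u x \<le> energy h x" if "h \<in> Q" for h using le m[OF that] by (rule order_trans)
  ultimately have "minimiser x u" unfolding minimiser_def by simp
  then show ?thesis by (rule exI)
qed

definition R where "R x = (THE u. minimiser x u)"

lemma R_eqI:
  assumes "minimiser x u"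
  shows "R x = u"
  unfolding R_def
proof (rule the_equality[where P = "minimiser x"])
  show "minimiser x u" by (rule assms)
  fix u' assume "minimiser x u'"
  then show "u' = u" using assms by (intro minimiser_unique[OF assms]) (simp_all add: minimiser_def)
qed

lemma minimiser_R: "minimiser x (R x)"
  using minimiser_exists R_eqI by metis

lemma R_in [simp]: "R x \<in> Q" and R_min: "h \<in> Q \<Longrightarrow> energy (R x) x \<le> energy h x"
  using minimiser_R[of x] unfolding minimiser_def by auto

text \<open>The half sum and half difference of \<open>R (x + y)\<close> and
  \<open>R (x - y)\<close> compete at \<open>x\<close> and \<open>y\<close>, while
  \<open>R x + R y\<close> and \<open>R x - R y\<close> compete at \<open>x + y\<close> and
  \<open>x - y\<close>. The two parallelogram inequalities close the circle, so
  \<open>R x + R y\<close> is minimal at \<open>x + y\<close>.\<close>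

lemma R_add: "R (x + y) = R x + R y"
proof -
  let ?a = "R (x + y)" and ?b = "R (x - y)" and ?h = "\<lambda>z. (1/2) *\<^sub>R z"
  have in_Q: "?h (?a + ?b) \<in> Q" "?h (?a - ?b) \<in> Q" by (auto intro!: Q)
  have half: "energy (?h v) (?h z) = energy v z / 4" if "v \<in> Q" for v z
    using energy_scale[OF that, of "1/2" z] by (simp add: scaleR_scaleC power2_eq_square)
  have "energy (R x) x \<le> energy (?h (?a + ?b)) (?h ((x + y) + (x - y)))"
    using R_min[OF in_Q(1), of x] by (simp add: scaleR_2[symmetric] del: scaleR_2)
  moreover have "energy (R y) y \<le> energy (?h (?a - ?b)) (?h ((x + y) - (x - y)))"
    using R_min[OF in_Q(2), of y] by (simp add: scaleR_2[symmetric] del: scaleR_2)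
  ultimately have 1: "2 * energy (R x) x + 2 * energy (R y) y \<le> energy ?a (x + y) + energy ?b (x - y)"
    using energy_parallelogram[OF R_in R_in, of "x + y" "x - y" "x + y" "x - y"]
      half[OF Q(2)[OF R_in R_in], of "x + y" "x - y" "x + y + (x - y)"]
      half[OF Q(5)[OF R_in R_in], of "x + y" "x - y" "x + y - (x - y)"] by linarith
  have "energy (R x + R y) (x + y) + energy (R x - R y) (x - y) \<le> energy ?a (x + y) + energy ?b (x - y)"
    using 1 energy_parallelogram[of "R x" "R y" x y] by simp
  moreover have "energy ?b (x - y) \<le> energy (R x - R y) (x - y)" by (rule R_min) (simp add: Q)
  ultimately have "energy (R x + R y) (x + y) \<le> energy ?a (x + y)" by simp
  then show ?thesis using minimiser_unique[OF minimiser_R, of "R x + R y" "x + y"] by (simp add: Q)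
qed

lemma R_scaleC: "R (c *\<^sub>C x) = c *\<^sub>C R x"
proof (cases "c = 0")
  case True
  have "energy 0 0 = 0" unfolding energy_def using scale[OF Q(1), of 0] by simp
  then have "R 0 = 0" using energy_nonneg by (intro R_eqI) (simp add: minimiser_def Q)
  then show ?thesis using True by simp
next
  case False
  show ?thesis
  proof (rule R_eqI, unfold minimiser_def, intro conjI ballI)
    fix h assume h: "h \<in> Q"
    have "energy h (c *\<^sub>C x) = (cmod c)\<^sup>2 * energy ((1/c) *\<^sub>C h) x"
      using energy_scale[of "(1/c) *\<^sub>C h" c x] h False by (simp add: Q scaleC_scaleC)
    then show "energy (c *\<^sub>C R x) (c *\<^sub>C x) \<le> energy h (c *\<^sub>C x)"
      using R_min[of "(1/c) *\<^sub>C h" x] h by (simp add: energy_scale Q mult_left_mono)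
  qed (simp add: Q)
qed

text \<open>Minimality gives the bound up to a quadratic error, which midpoint convexity removes.\<close>

lemma form_lower_bound_aux:
  assumes "h \<in> Q"
  shows "- ((1/2)^n) * (norm (h - R x))\<^sup>2 \<le> q h - q (R x) - 2 * Re (cinner (h - R x) (x - R x))"
  using assms
proof (induction n arbitrary: h)
  case 0
  have "h - x = (h - R x) - (x - R x)" by simp
  then have "(norm (h - x))\<^sup>2 = (norm (h - R x))\<^sup>2 - 2 * Re (cinner (h - R x) (x - R x)) + (norm (R x - x))\<^sup>2"
    by (simp only: norm_diff_sq[of "h - R x"] norm_minus_commute[of "R x"])
  then show ?case using R_min[OF 0, of x] unfolding energy_def by simp
next
  case (Suc n)
  let ?u = "R x" let ?k = "(1/2) *\<^sub>R (?u + h)"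
  have k: "?k \<in> Q" using Suc.prems by (simp add: Q)
  have diff: "?k - ?u = (1/2) *\<^sub>R (h - ?u)" by (simp add: algebra_simps flip: scaleR_add_left)
  \<comment> \<open>Moving to the midpoint halves the linear term but quarters the squared distance;
    after doubling, the error has lost a factor 2.\<close>
  have "4 * q ?k \<le> 2 * q ?u + 2 * q h"
    using parallelogram[of ?u h] nonneg[of "?u - h"] scaleR[of "?u + h" "1/2"] Suc.prems
    by (simp add: Q power2_eq_square)
  moreover have "- ((1/2)^n) * ((norm (h - ?u))\<^sup>2 / 4) \<le> q ?k - q ?u - Re (cinner (h - ?u) (x - ?u))"
    using Suc.IH[OF k] unfolding diff
    by (simp add: cinner_scaleR_left power_mult_distrib power2_eq_square)
  ultimately show ?case by simp
qed

text \<open>This is the Euler-Lagrange condition of the minimisation: \<open>x - R x\<close> is a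
  subgradient of \<open>q / 2\<close> at \<open>R x\<close>. It expresses
  \<open>K (R x) = x - R x\<close> before any operator K is available.\<close>

lemma form_lower_bound:
  assumes "h \<in> Q"
  shows "q (R x) + 2 * Re (cinner (h - R x) (x - R x)) \<le> q h"
proof -
  have "(\<lambda>n. - ((1/2)^n) * (norm (h - R x))\<^sup>2) \<longlonglongrightarrow> - 0 * (norm (h - R x))\<^sup>2"
    by (intro tendsto_intros LIMSEQ_realpow_zero) auto
  then have "- 0 * (norm (h - R x))\<^sup>2 \<le> q h - q (R x) - 2 * Re (cinner (h - R x) (x - R x))"
    by (rule LIMSEQ_le_const2) (use form_lower_bound_aux[OF assms] in blast)
  then show ?thesis by simp
qed

lemma form_R: "cinner (R x) (x - R x) = of_real (q (R x))"
proof -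
  let ?u = "R x" and ?y = "x - R x"
  define z where "z = cinner ?u ?y"
  \<comment> \<open>The competitor is a multiple of \<open>R x\<close> itself. Varying
    \<open>c\<close> around 1 in the real direction yields the real part of the claim, in the
    imaginary direction the imaginary part.\<close>
  have ineq: "q ?u + 2 * Re (cnj c * z - z) \<le> (cmod c)\<^sup>2 * q ?u" for c
    using form_lower_bound[of "c *\<^sub>C ?u" x] scale[of ?u c]
    by (simp add: Q z_def cinner_diff_left cinner_scaleC_left)
  have "t * (2 * Re z - 2 * q ?u) \<le> t\<^sup>2 * q ?u" for t
  proof -
    have "(cmod (1 + of_real t))\<^sup>2 = 1 + 2 * t + t\<^sup>2" unfolding cmod_power2 by (simp add: power2_eq_square algebra_simps)
    then show ?thesis using ineq[of "1 + of_real t"] by (simp add: algebra_simps)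
  qed
  then have "2 * Re z - 2 * q ?u = 0" by (rule quadratic_bound_zero)
  moreover have "t * (2 * Im z) \<le> t\<^sup>2 * q ?u" for t
  proof -
    have "(cmod (1 + of_real t * \<i>))\<^sup>2 = 1 + t\<^sup>2" by (simp add: cmod_power2)
    then show ?thesis using ineq[of "1 + of_real t * \<i>"] by (simp add: algebra_simps)
  qed
  then have "2 * Im z = 0" by (rule quadratic_bound_zero)
  ultimately show ?thesis by (simp add: z_def[symmetric] complex_eq_iff)
qed

end

section \<open>Orthogonal projection and representation of functionals\<close>

lemma exists_orthogonal:
  fixes M :: "'a::chilbert_space set"
  assumes "csubspace M" and "closed M" and "M \<noteq> UNIV"
  obtains y where "y \<noteq> 0" "\<And>h. h \<in> M \<Longrightarrow> cinner h y = 0"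
proof -
  \<comment> \<open>For the zero form on \<open>M\<close> the energy is the squared distance, so
    \<open>R x\<close> is the point of \<open>M\<close> nearest to \<open>x\<close>.\<close>
  interpret closed_form M "\<lambda>_. 0"
    by unfold_locales (use assms in \<open>auto simp: closed_sequential_limits\<close>)
  obtain x where x: "x \<notin> M" using assms(3) by blast
  let ?y = "x - R x"
  have le: "Re (cinner h ?y) \<le> 0" if "h \<in> M" for h
    using form_lower_bound[of "h + R x" x] that by (simp add: Q)
  have "cinner h ?y = 0" if "h \<in> M" for h
  proof -
    have "Re (cinner (c *\<^sub>C h) ?y) \<le> 0" for c using le that by (simp add: Q)
    from this[of 1] this[of "-1"] this[of "\<i>"] this[of "-\<i>"] show ?thesis
      by (simp add: cinner_scaleC_left complex_eq_iff)
  qed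
  moreover have "?y \<noteq> 0" using x R_in[of x] by (metis right_minus_eq)
  ultimately show ?thesis using that by blast
qed

lemma closure_eq_UNIV_iff_orthogonal:
  fixes M :: "'a::chilbert_space set"
  assumes "csubspace M" and "\<And>y. (\<And>h. h \<in> M \<Longrightarrow> cinner h y = 0) \<Longrightarrow> y = 0"
  shows "closure M = UNIV"
proof (rule ccontr)
  assume "closure M \<noteq> UNIV"
  then obtain y where "y \<noteq> 0" "\<And>h. h \<in> closure M \<Longrightarrow> cinner h y = 0"
    using exists_orthogonal[OF csubspace_closure[OF assms(1)]] by auto
  then show False using assms(2)[of y] closure_subset by blast
qed

text \<open>The functional \<open>g \<mapsto> \<langle>h, S g\<rangle>\<close> is represented by the vector orthogonal to the closure of
  its graph.\<close>

lemma riesz_dense: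
  fixes S :: "'a::chilbert_space lop"
  assumes S: "linear_op S" "densely_defined S"
    and bound: "\<And>g k. (g, k) \<in> S \<Longrightarrow> cmod (cinner h k) \<le> M * norm g"
    and M: "0 \<le> M"
  shows "\<exists>b. (h, b) \<in> adjoint_op S \<and> norm b \<le> M"
proof -
  define G where "G = {(g, cinner h k) | g k. (g, k) \<in> S}"
  have G: "csubspace G"
    unfolding csubspace_def
  proof (intro conjI ballI allI)
    show "0 \<in> G" using S by (force simp: G_def linear_op_def zero_prod_def)
    fix x assume "x \<in> G"
    then obtain g k where x: "x = (g, cinner h k)" "(g, k) \<in> S" unfolding G_def by blast
    show "c *\<^sub>C x \<in> G" for c
    proof -
      have "(c *\<^sub>C g, c *\<^sub>C k) \<in> S" using S x unfolding linear_op_def by blast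
      then show ?thesis
        unfolding G_def x scaleC_prod_def by (force simp: scaleC_complex_def cinner_scaleC_right)
    qed
    fix y assume "y \<in> G"
    then obtain g' k' where y: "y = (g', cinner h k')" "(g', k') \<in> S" unfolding G_def by blast
    have "(g + g', k + k') \<in> S" using S x y unfolding linear_op_def by blast
    then show "x + y \<in> G" unfolding G_def x y by (force simp: cinner_add_right)
  qed
  have bound': "cmod t \<le> M * norm x" if xt: "(x, t) \<in> closure G" for x t
  proof -
    obtain s where s: "\<And>n. s n \<in> G" "s \<longlonglongrightarrow> (x, t)"
      using xt unfolding closure_sequential by blast
    have "(\<lambda>n. cmod (snd (s n))) \<longlonglongrightarrow> cmod (snd (x, t))" "(\<lambda>n. M * norm (fst (s n))) \<longlonglongrightarrow> M * norm (fst (x, t))"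
      by (intro tendsto_intros s)+
    moreover have "cmod (snd (s n)) \<le> M * norm (fst (s n))" for n
      using s(1)[of n] bound unfolding G_def by force
    ultimately show ?thesis by (auto intro: LIMSEQ_le)
  qed
  \<comment> \<open>The bound survives in the closure, so the closed graph is a proper subspace and
    has a nonzero orthogonal vector.\<close>
  have "(0, 1) \<notin> closure G" using bound'[of 0 1] by auto
  then obtain y where y: "y \<noteq> 0" "\<And>z. z \<in> closure G \<Longrightarrow> cinner z y = 0"
    using exists_orthogonal[OF csubspace_closure[OF G]] by (metis UNIV_I closed_closure)
  obtain a \<beta> where ab: "y = (a, \<beta>)" by fastforce
  have orth: "cinner g a + cnj (cinner h k) * \<beta> = 0" if "(g, k) \<in> S" for g k
  proof -
    have "(g, cinner h k) \<in> closure G" using that closure_subset unfolding G_def by fastforce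
    then show ?thesis using y(2) unfolding ab by (force simp: cinner_prod_def cinner_complex_def)
  qed
  have \<beta>: "\<beta> \<noteq> 0"
  proof
    assume \<beta>: "\<beta> = 0"
    have "a = 0"
      using orth \<beta> S(2) unfolding densely_defined_def
      by (intro eq_if_cinner_dense_eq[of "Domain S"]) auto
    then show False using y(1) ab \<beta> by (simp add: zero_prod_def)
  qed
  \<comment> \<open>Solves the relation \<open>orth\<close> for the conjugate of
    \<open>cinner h k\<close>; \<beta> is nonzero because otherwise \<open>a\<close> would be
    orthogonal to the dense domain.\<close>
  define b where "b = (- 1 / \<beta>) *\<^sub>C a"
  have b: "cinner h k = cinner b g" if "(g, k) \<in> S" for g k
  proof -
    have "cnj (cinner h k) = cinner g b"
      using orth[OF that] \<beta> by (simp add: b_def cinner_scaleC_right divide_simps add_eq_0_iff)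
    then show ?thesis by (metis cinner_commute complex_cnj_cnj)
  qed
  then have adj: "(h, b) \<in> adjoint_op S" unfolding adjoint_op_def by auto
  have "norm b \<le> M"
  proof (cases "b = 0")
    case True
    then show ?thesis using M by simp
  next
    case False
    have "b \<in> closure (Domain S)" using S(2) by (simp add: densely_defined_def)
    then obtain s where s: "\<And>n. s n \<in> Domain S" "s \<longlonglongrightarrow> b" unfolding closure_sequential by blast
    have "(\<lambda>n. cmod (cinner b (s n))) \<longlonglongrightarrow> cmod (cinner b b)" "(\<lambda>n. M * norm (s n)) \<longlonglongrightarrow> M * norm b"
      by (intro tendsto_intros s)+
    moreover have "cmod (cinner b (s n)) \<le> M * norm (s n)" for n
      using s(1)[of n] bound b by (metis DomainE)
    ultimately have "cmod (cinner b b) \<le> M * norm b" by (auto intro: LIMSEQ_le)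
    then show ?thesis using False by (simp add: cinner_self norm_mult power2_eq_square)
  qed
  with adj show ?thesis by blast
qed

section \<open>Selfadjoint operators\<close>

lemma linear_opD:
  assumes "linear_op (T :: 'a::complex_vector lop)"
  shows "(0, 0) \<in> T" "\<And>f g f' g'. (f, g) \<in> T \<Longrightarrow> (f', g') \<in> T \<Longrightarrow> (f + f', g + g') \<in> T"
    "\<And>c f g. (f, g) \<in> T \<Longrightarrow> (c *\<^sub>C f, c *\<^sub>C g) \<in> T"
    "\<And>f g f' g'. (f, g) \<in> T \<Longrightarrow> (f', g') \<in> T \<Longrightarrow> (f - f', g - g') \<in> T"
    "\<And>r f g. (f, g) \<in> T \<Longrightarrow> (r *\<^sub>R f, r *\<^sub>R g) \<in> T"
    "\<And>f g g'. (f, g) \<in> T \<Longrightarrow> (f, g') \<in> T \<Longrightarrow> g = g'"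
    "\<And>f g. (f, g) \<in> T \<Longrightarrow> T \<cdot>\<^sub>o f = g"
proof -
  show *: "(0, 0) \<in> T" "\<And>f g f' g'. (f, g) \<in> T \<Longrightarrow> (f', g') \<in> T \<Longrightarrow> (f + f', g + g') \<in> T"
    "\<And>c f g. (f, g) \<in> T \<Longrightarrow> (c *\<^sub>C f, c *\<^sub>C g) \<in> T"
    using assms unfolding linear_op_def by fast+
  show R: "\<And>r f g. (f, g) \<in> T \<Longrightarrow> (r *\<^sub>R f, r *\<^sub>R g) \<in> T" by (simp add: scaleR_scaleC *(3))
  show "(f - f', g - g') \<in> T" if "(f, g) \<in> T" "(f', g') \<in> T" for f g f' g'
    using *(2)[OF that(1) R[OF that(2), of "-1"]] by simp
  show sv: "\<And>f g g'. (f, g) \<in> T \<Longrightarrow> (f, g') \<in> T \<Longrightarrow> g = g'"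
    using assms unfolding linear_op_def single_valued_def by blast
  show "\<And>f g. (f, g) \<in> T \<Longrightarrow> T \<cdot>\<^sub>o f = g" unfolding op_app_def using sv by blast
qed

lemma linear_opI:
  assumes "csubspace T" and "\<And>g. (0, g) \<in> T \<Longrightarrow> g = 0"
  shows "linear_op (T :: 'a::complex_inner lop)"
proof -
  note T = csubspaceD[OF assms(1)]
  have "single_valued T"
    unfolding single_valued_def
  proof (intro allI impI)
    fix f g g' assume "(f, g) \<in> T" "(f, g') \<in> T"
    then have "(f, g) - (f, g') \<in> T" by (rule T(5))
    then show "g = g'" using assms(2)[of "g - g'"] by simp
  qed
  then show ?thesis
    unfolding linear_op_def using T(1) T(2,3)[of "(_, _)"] by (auto simp: zero_prod_def scaleC_prod_def)
qed

lemma csubspace_Domain: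
  assumes "linear_op (T :: 'a::complex_inner lop)"
  shows "csubspace (Domain T)"
  using linear_opD(1-3)[OF assms] unfolding csubspace_def by (blast intro: DomainI elim: DomainE)

lemma adjointD: "(g, h) \<in> adjoint_op T \<Longrightarrow> (f, k) \<in> T \<Longrightarrow> cinner g k = cinner h f"
  unfolding adjoint_op_def by blast

lemma adjointI: "(\<And>f k. (f, k) \<in> T \<Longrightarrow> cinner g k = cinner h f) \<Longrightarrow> (g, h) \<in> adjoint_op T"
  unfolding adjoint_op_def by blast

lemma adjoint_antimono: "S \<subseteq> T \<Longrightarrow> adjoint_op T \<subseteq> adjoint_op S"
  unfolding adjoint_op_def by blast

lemma csubspace_adjoint: "csubspace (adjoint_op (T :: 'a::complex_inner lop))"
  unfolding csubspace_def
  unfolding adjoint_op_def by (fastforce simp: zero_prod_def scaleC_prod_def cinner_simps)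

lemma linear_op_adjoint:
  assumes "densely_defined (T :: 'a::complex_inner lop)"
  shows "linear_op (adjoint_op T)"
proof (rule linear_opI[OF csubspace_adjoint])
  fix h assume h: "(0, h) \<in> adjoint_op T"
  show "h = 0"
  proof (rule eq_if_cinner_dense_eq)
    show "closure (Domain T) = UNIV" using assms by (simp add: densely_defined_def)
    fix z assume "z \<in> Domain T"
    then obtain k where "(z, k) \<in> T" by blast
    then show "cinner z h = cinner z 0" using adjointD[OF h] cinner_commute[of z h] by auto
  qed
qed

lemma closed_adjoint: "closed (adjoint_op (T :: 'a::complex_inner lop))"
  unfolding closed_sequential_limits
proof (intro allI impI, elim conjE)
  fix s l assume s: "\<forall>n. s n \<in> adjoint_op T" "s \<longlonglongrightarrow> l"
  have "(fst l, snd l) \<in> adjoint_op T"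
  proof (rule adjointI)
    fix f k assume fk: "(f, k) \<in> T"
    have "(\<lambda>n. cinner (fst (s n)) k) \<longlonglongrightarrow> cinner (fst l) k" "(\<lambda>n. cinner (snd (s n)) f) \<longlonglongrightarrow> cinner (snd l) f"
      by (intro tendsto_intros s)+
    moreover have "cinner (fst (s n)) k = cinner (snd (s n)) f" for n
      using s(1) fk by (intro adjointD[of _ _ T]) auto
    ultimately show "cinner (fst l) k = cinner (snd l) f" using LIMSEQ_unique by fastforce
  qed
  then show "l \<in> adjoint_op T" by simp
qed

lemma nonneg_opD:
  assumes "linear_op T" "nonneg_op T" "(f, g) \<in> T"
  shows "Im (cinner f g) = 0" "0 \<le> Re (cinner f g)"
  using assms(2,3) linear_opD(7)[OF assms(1,3)] unfolding nonneg_op_def by auto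

lemma nonneg_opI:
  assumes "linear_op T" "\<And>f g. (f, g) \<in> T \<Longrightarrow> Im (cinner f g) = 0 \<and> 0 \<le> Re (cinner f g)"
  shows "nonneg_op T"
  unfolding nonneg_op_def
proof (intro ballI)
  fix f assume "f \<in> Domain T"
  then obtain g where g: "(f, g) \<in> T" by blast
  show "Im (cinner f (T \<cdot>\<^sub>o f)) = 0 \<and> 0 \<le> Re (cinner f (T \<cdot>\<^sub>o f))"
    using assms(2)[OF g] linear_opD(7)[OF assms(1) g] by simp
qed

lemma selfadjointD:
  assumes "selfadjoint T"
  shows "linear_op T" "densely_defined T" "adjoint_op T = T"
    "\<And>f g f' g'. (f, g) \<in> T \<Longrightarrow> (f', g') \<in> T \<Longrightarrow> cinner f g' = cinner g f'"
proof -
  show *: "linear_op T" "densely_defined T" "adjoint_op T = T"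
    using assms by (auto simp: selfadjoint_def)
  then show "\<And>f g f' g'. (f, g) \<in> T \<Longrightarrow> (f', g') \<in> T \<Longrightarrow> cinner f g' = cinner g f'"
    by (metis adjointD)
qed

lemma norm_le_norm_add:
  assumes "0 \<le> Re (cinner f (g::'a::complex_inner))"
  shows "norm f \<le> norm (f + g)"
proof (rule power2_le_imp_le)
  show "(norm f)\<^sup>2 \<le> (norm (f + g))\<^sup>2" unfolding norm_add_sq using assms by simp
qed simp

text \<open>The operator \<open>1 + \<epsilon> B\<close> is bounded below, so its range is closed. A
  vector \<open>y\<close> orthogonal to the range satisfies \<open>B y = - y / \<epsilon>\<close> by
  selfadjointness, against nonnegativity unless \<open>y = 0\<close>. The resolvent itself takes
  \<epsilon> = 1; small \<epsilon> serve as a regularisation in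
  \<open>form_domain_sqrt\<close>.\<close>

lemma resolvent_surj:
  fixes B :: "'a::chilbert_space lop"
  assumes B: "selfadjoint B" "nonneg_op B" and \<epsilon>: "0 < \<epsilon>"
  obtains f g where "(f, g) \<in> B" "x = f + \<epsilon> *\<^sub>R g"
proof -
  note lin = linear_opD[OF selfadjointD(1)[OF B(1)]]
  have pos: "0 \<le> Re (cinner f g)" if "(f, g) \<in> B" for f g
    using nonneg_opD(2)[OF selfadjointD(1)[OF B(1)] B(2) that] .
  have le: "norm f \<le> norm (f + \<epsilon> *\<^sub>R g)" if "(f, g) \<in> B" for f g
    using pos[OF that] \<epsilon> by (intro norm_le_norm_add) (simp add: cinner_simps)
  define M where "M = (\<lambda>(f, g). f + \<epsilon> *\<^sub>R g) ` B"
  have MI: "f + \<epsilon> *\<^sub>R g \<in> M" if "(f, g) \<in> B" for f g using that unfolding M_def by force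
  have ME: "\<exists>f g. (f, g) \<in> B \<and> z = f + \<epsilon> *\<^sub>R g" if "z \<in> M" for z using that unfolding M_def by force
  have sub: "csubspace M"
    unfolding csubspace_def
  proof (intro conjI ballI allI)
    show "0 \<in> M" using MI[OF lin(1)] by simp
    fix z assume "z \<in> M"
    then obtain f g where z: "(f, g) \<in> B" "z = f + \<epsilon> *\<^sub>R g" using ME by blast
    show "c *\<^sub>C z \<in> M" for c
      using MI[OF lin(3)[OF z(1), of c]] unfolding z(2)
      by (simp add: scaleC_add_right scaleR_scaleC scaleC_scaleC mult.commute)
    fix w assume "w \<in> M"
    then obtain f' g' where w: "(f', g') \<in> B" "w = f' + \<epsilon> *\<^sub>R g'" using ME by blast
    show "z + w \<in> M"
      using MI[OF lin(2)[OF z(1) w(1)]] unfolding z(2) w(2) by (simp add: algebra_simps)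
  qed
  have closed: "closed M"
    unfolding closed_sequential_limits
  proof (intro allI impI, elim conjE)
    fix z l assume z: "\<forall>n. z n \<in> M" "z \<longlonglongrightarrow> l"
    then have "\<forall>n. \<exists>f g. (f, g) \<in> B \<and> z n = f + \<epsilon> *\<^sub>R g" using ME by blast
    then obtain f g where fg: "\<And>n. (f n, g n) \<in> B" "\<And>n. z n = f n + \<epsilon> *\<^sub>R g n" by metis
    have "Cauchy f"
    proof (rule metric_CauchyI)
      fix e :: real assume "0 < e"
      then obtain N where N: "\<And>m n. m \<ge> N \<Longrightarrow> n \<ge> N \<Longrightarrow> dist (z m) (z n) < e"
        using metric_CauchyD[OF LIMSEQ_imp_Cauchy[OF z(2)]] by blast
      have "dist (f m) (f n) \<le> dist (z m) (z n)" for m n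
        using le[OF lin(4)[OF fg(1)[of m] fg(1)[of n]]] by (simp add: dist_norm fg(2) algebra_simps)
      then show "\<exists>M. \<forall>m\<ge>M. \<forall>n\<ge>M. dist (f m) (f n) < e" using N le_less_trans by blast
    qed
    then obtain a where a: "f \<longlonglongrightarrow> a" using Cauchy_convergent convergent_def by blast
    have g: "g = (\<lambda>n. (1/\<epsilon>) *\<^sub>R (z n - f n))" using \<epsilon> by (simp add: fg(2))
    have "(\<lambda>n. (f n, g n)) \<longlonglongrightarrow> (a, (1/\<epsilon>) *\<^sub>R (l - a))"
      unfolding g by (intro tendsto_intros a z)
    moreover have "closed B" using closed_adjoint[of B] selfadjointD(3)[OF B(1)] by simp
    ultimately have "(a, (1/\<epsilon>) *\<^sub>R (l - a)) \<in> B"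
      using closed_sequentially[of B "\<lambda>n. (f n, g n)"] fg(1) by simp
    then show "l \<in> M" using MI \<epsilon> by fastforce
  qed
  have "M = UNIV"
  proof (rule ccontr)
    assume "M \<noteq> UNIV"
    then obtain y where y: "y \<noteq> 0" "\<And>z. z \<in> M \<Longrightarrow> cinner z y = 0"
      using exists_orthogonal[OF sub closed] by metis
    have "(y, (- 1 / \<epsilon>) *\<^sub>R y) \<in> adjoint_op B"
    proof (rule adjointI)
      fix f k assume fk: "(f, k) \<in> B"
      have "cinner y (f + \<epsilon> *\<^sub>R k) = 0" using y(2)[OF MI[OF fk]] cinner_commute by (metis complex_cnj_zero)
      then show "cinner y k = cinner ((- 1 / \<epsilon>) *\<^sub>R y) f"
        using \<epsilon> by (simp add: cinner_simps divide_simps add_eq_0_iff mult.commute)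
    qed
    then have "0 \<le> Re (cinner y ((- 1 / \<epsilon>) *\<^sub>R y))" unfolding selfadjointD(3)[OF B(1)] by (rule pos)
    then have "(norm y)\<^sup>2 \<le> 0"
      using \<epsilon> by (simp add: cinner_scaleR_right cinner_self divide_simps del: zero_le_power2 power2_less_eq_zero_iff)
    then show False using y(1) by simp
  qed
  then have "x \<in> M" by simp
  then show ?thesis using ME that by metis
qed

section \<open>Bounded selfadjoint operators and the resolvent\<close>

definition selfadjoint_blinfun :: "('a::complex_inner \<Rightarrow>\<^sub>L 'a) \<Rightarrow> bool" where
  "selfadjoint_blinfun T \<longleftrightarrow> (\<forall>x y. cinner (T x) y = cinner x (T y))"

lemma selfadjoint_blinfunD: "selfadjoint_blinfun T \<Longrightarrow> cinner (T x) y = cinner x (T y)"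
  by (simp add: selfadjoint_blinfun_def)

text \<open>Bounded linear functions are only real-linear by type; symmetry with respect to the
  complex inner product forces complex linearity.\<close>

lemma selfadjoint_blinfun_scaleC: "selfadjoint_blinfun T \<Longrightarrow> T (c *\<^sub>C x) = c *\<^sub>C T x"
  by (rule eq_if_cinner_eq) (simp add: selfadjoint_blinfunD[symmetric] cinner_scaleC_right)

text \<open>Nonnegativity makes both \<open>f\<close> and \<open>g\<close> no longer than
  \<open>f + g\<close>. The two resulting contraction bounds play the role of
  \<open>0 <= R <= 1\<close> and are what the square root iteration needs for \<open>1 - R\<close>
  and for \<open>R\<close>.\<close>

lemma resolvent_exists:
  fixes B :: "'a::chilbert_space lop"
  assumes B: "selfadjoint B" "nonneg_op B"
  obtains R :: "'a \<Rightarrow>\<^sub>L 'a" where "selfadjoint_blinfun R" "norm R \<le> 1" "norm (id_blinfun - R) \<le> 1"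
    "B = range (\<lambda>x. (R x, x - R x))"
proof -
  note lin = linear_opD[OF selfadjointD(1)[OF B(1)]]
  note sym = selfadjointD(4)[OF B(1)]
  have pos: "0 \<le> Re (cinner f g)" if "(f, g) \<in> B" for f g
    using nonneg_opD(2)[OF selfadjointD(1)[OF B(1)] B(2) that] .
  have "\<exists>f. (f, x - f) \<in> B" for x
    using resolvent_surj[OF B, of 1 x] by (metis add_diff_cancel_left' scaleR_one zero_less_one)
  then obtain r where r: "\<And>x. (r x, x - r x) \<in> B" by metis
  have le: "norm f \<le> norm (f + g)" "norm g \<le> norm (f + g)" if "(f, g) \<in> B" for f g
    using norm_le_norm_add[OF pos[OF that]] norm_le_norm_add[of g f] pos[OF that] Re_cinner_commute[of f g]
    by (simp_all add: add.commute)
  have uniq: "r (f + g) = f" if "(f, g) \<in> B" for f g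
    using le(1)[OF lin(4)[OF r[of "f + g"] that]] by simp
  have "bounded_linear r"
  proof (rule bounded_linear_intro[where K = 1])
    show "r (x + y) = r x + r y" for x y
      using uniq[OF lin(2)[OF r[of x] r[of y]]] by simp
    show "r (c *\<^sub>R x) = c *\<^sub>R r x" for c x
      using uniq[OF lin(5)[OF r[of x], of c]] by (simp add: scaleR_right_diff_distrib)
    show "norm (r x) \<le> norm x * 1" for x
      using le(1)[OF r[of x]] by simp
  qed
  then have R: "blinfun_apply (Blinfun r) = r" by (rule bounded_linear_Blinfun_apply)
  show thesis
  proof
    show "selfadjoint_blinfun (Blinfun r)"
      unfolding selfadjoint_blinfun_def R
    proof (intro allI)
      fix x y
      have "cinner (r x) (r y + (y - r y)) = cinner (r x + (x - r x)) (r y)"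
        unfolding cinner_add_left cinner_add_right using sym[OF r r, of x y] by simp
      then show "cinner (r x) y = cinner x (r y)" by simp
    qed
    show "norm (Blinfun r) \<le> 1"
      by (rule norm_blinfun_bound) (use le(1)[OF r] in \<open>simp_all add: R\<close>)
    show "norm (id_blinfun - Blinfun r) \<le> 1"
      by (rule norm_blinfun_bound) (use le(2)[OF r] in \<open>simp_all add: R blinfun.diff_left\<close>)
    show "B = range (\<lambda>x. (Blinfun r x, x - Blinfun r x))"
    proof (intro equalityI subsetI)
      fix z assume "z \<in> B"
      then obtain f g where z: "z = (f, g)" "(f, g) \<in> B" by (cases z) auto
      have "z = (r (f + g), (f + g) - r (f + g))" using uniq[OF z(2)] z(1) by simp
      then show "z \<in> range (\<lambda>x. (Blinfun r x, x - Blinfun r x))" unfolding R by blast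
    qed (auto simp: R r)
  qed
qed

section \<open>Square roots\<close>

text \<open>A fixed point Y satisfies \<open>2 Y = X + Y^2\<close>, that is
  \<open>(1 - Y)^2 = 1 - X\<close>.\<close>

primrec sqrt_seq :: "('a::chilbert_space \<Rightarrow>\<^sub>L 'a) \<Rightarrow> nat \<Rightarrow> 'a \<Rightarrow>\<^sub>L 'a" where
  "sqrt_seq X 0 = 0"
| "sqrt_seq X (Suc n) = (1/2) *\<^sub>R (X + (sqrt_seq X n o\<^sub>L sqrt_seq X n))"

text \<open>The same iteration for the number 1 in place of X. It majorises the operator iteration,
  also in its increments, so a bounded increasing real sequence controls norm convergence.\<close>

primrec sqrt_major :: "nat \<Rightarrow> real" where
  "sqrt_major 0 = 0"
| "sqrt_major (Suc n) = (1 + (sqrt_major n)\<^sup>2) / 2"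

lemma sqrt_major_bounds: "0 \<le> sqrt_major n \<and> sqrt_major n \<le> 1"
  by (induction n) (auto simp: power_le_one)

lemma sqrt_seq_Suc_apply:
  "sqrt_seq X (Suc n) x = (1/2) *\<^sub>R (X x + sqrt_seq X n (sqrt_seq X n x))"
  by (simp add: blinfun.scaleR_left blinfun.add_left)

lemma sqrt_seq_commute:
  fixes T X :: "'a::chilbert_space \<Rightarrow>\<^sub>L 'a"
  assumes "\<And>x. T (X x) = X (T x)"
  shows "T (sqrt_seq X n x) = sqrt_seq X n (T x)"
  by (induction n arbitrary: x)
    (simp_all add: blinfun.zero_left blinfun.zero_right blinfun.scaleR_left blinfun.scaleR_right
      blinfun.add_left blinfun.add_right assms)

lemma sqrt_seq_commute_self: "sqrt_seq X m (sqrt_seq X n x) = sqrt_seq X n (sqrt_seq X m x)"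
  by (intro sqrt_seq_commute sqrt_seq_commute[symmetric]) simp

lemma selfadjoint_blinfun_sqrt_seq: "selfadjoint_blinfun X \<Longrightarrow> selfadjoint_blinfun (sqrt_seq X n)"
  by (induction n)
    (simp_all add: selfadjoint_blinfun_def blinfun.zero_left blinfun.scaleR_left blinfun.add_left cinner_simps)

lemma norm_sqrt_seq:
  assumes "norm X \<le> 1"
  shows "norm (sqrt_seq X n) \<le> sqrt_major n"
proof (induction n)
  case (Suc n)
  have "norm (sqrt_seq X n o\<^sub>L sqrt_seq X n) \<le> norm (sqrt_seq X n) * norm (sqrt_seq X n)"
    by (rule norm_blinfun_compose)
  also have "\<dots> \<le> (sqrt_major n)\<^sup>2"
    unfolding power2_eq_square using Suc sqrt_major_bounds[of n] by (intro mult_mono) auto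
  finally show ?case using assms norm_triangle_ineq[of X "sqrt_seq X n o\<^sub>L sqrt_seq X n"]
    by (simp add: mult.commute)
qed simp

lemma norm_sqrt_seq_Suc_diff:
  assumes "norm X \<le> 1"
  shows "norm (sqrt_seq X (Suc n) - sqrt_seq X n) \<le> sqrt_major (Suc n) - sqrt_major n"
proof (induction n)
  case 0
  then show ?case using assms by simp
next
  case (Suc n)
  let ?a = "sqrt_seq X (Suc n)" and ?b = "sqrt_seq X n"
  let ?s = "sqrt_major (Suc n)" and ?t = "sqrt_major n"
  \<comment> \<open>Difference of squares, legitimate because all iterates commute with each
    other.\<close>
  have "sqrt_seq X (Suc (Suc n)) - ?a = (1/2) *\<^sub>R ((?a - ?b) o\<^sub>L (?a + ?b))"
  proof (rule blinfun_eqI)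
    fix x
    have "sqrt_seq X (Suc (Suc n)) x - ?a x = (1/2) *\<^sub>R (?a (?a x) - ?b (?b x))"
      using sqrt_seq_Suc_apply[of X "Suc n" x] sqrt_seq_Suc_apply[of X n x]
      by (metis add_diff_cancel_left scaleR_right_diff_distrib)
    then show "(sqrt_seq X (Suc (Suc n)) - ?a) x = ((1/2) *\<^sub>R ((?a - ?b) o\<^sub>L (?a + ?b))) x"
      by (simp add: blinfun.diff_left blinfun.scaleR_left blinfun.add_left blinfun.add_right
          sqrt_seq_commute_self[of X n "Suc n"] del: sqrt_seq.simps)
  qed
  then have "norm (sqrt_seq X (Suc (Suc n)) - ?a) \<le> 1/2 * (norm (?a - ?b) * norm (?a + ?b))"
    using norm_blinfun_compose[of "?a - ?b" "?a + ?b"] by simp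
  also have "\<dots> \<le> 1/2 * ((?s - ?t) * (?s + ?t))"
  proof (intro mult_left_mono mult_mono)
    show "norm (?a + ?b) \<le> ?s + ?t"
      using norm_triangle_ineq[of ?a ?b] norm_sqrt_seq[OF assms, of n]
        norm_sqrt_seq[OF assms, of "Suc n"] by linarith
    show "0 \<le> ?s - ?t" using Suc norm_ge_zero order_trans by blast
  qed (use Suc in simp_all)
  also have "\<dots> = sqrt_major (Suc (Suc n)) - ?s"
    by (simp add: power2_eq_square algebra_simps)
  finally show ?case .
qed

lemma norm_sqrt_seq_diff:
  assumes "norm X \<le> 1" "n \<le> m"
  shows "norm (sqrt_seq X m - sqrt_seq X n) \<le> sqrt_major m - sqrt_major n"
  using assms(2)
proof (induction m rule: dec_induct)
  case (step m)
  show ?case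
    using step.IH norm_sqrt_seq_Suc_diff[OF assms(1), of m]
      norm_triangle_ineq[of "sqrt_seq X (Suc m) - sqrt_seq X m" "sqrt_seq X m - sqrt_seq X n"]
    by (simp del: sqrt_seq.simps sqrt_major.simps)
qed simp

lemma convergent_sqrt_seq:
  assumes "norm (X :: 'a::chilbert_space \<Rightarrow>\<^sub>L 'a) \<le> 1"
  shows "convergent (sqrt_seq X)"
proof -
  have "incseq sqrt_major"
  proof (rule incseq_SucI)
    \<comment> \<open>Monotonicity of the majorant is read off from the operator estimate, whose
      left side is a norm.\<close>
    have "0 \<le> sqrt_major (Suc n) - sqrt_major n" for n
      using norm_sqrt_seq_Suc_diff[OF assms, of n] norm_ge_zero order_trans by blast
    then show "sqrt_major n \<le> sqrt_major (Suc n)" for n by simp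
  qed
  then have "Cauchy sqrt_major"
    using sqrt_major_bounds by (metis LIMSEQ_imp_Cauchy incseq_convergent)
  have "Cauchy (sqrt_seq X)"
  proof (rule metric_CauchyI)
    fix e :: real assume "0 < e"
    then obtain N where N: "\<And>m n. m \<ge> N \<Longrightarrow> n \<ge> N \<Longrightarrow> dist (sqrt_major m) (sqrt_major n) < e"
      using metric_CauchyD[OF \<open>Cauchy sqrt_major\<close>] by blast
    have "dist (sqrt_seq X m) (sqrt_seq X n) \<le> dist (sqrt_major m) (sqrt_major n)" for m n
    proof (cases "n \<le> m")
      case True
      then show ?thesis
        using norm_sqrt_seq_diff[OF assms True] unfolding dist_norm by simp
    next
      case False
      then show ?thesis
        using norm_sqrt_seq_diff[OF assms, of m n] unfolding dist_commute[of "sqrt_seq X m"]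
        by (simp add: dist_norm)
    qed
    then show "\<exists>M. \<forall>m\<ge>M. \<forall>n\<ge>M. dist (sqrt_seq X m) (sqrt_seq X n) < e"
      using N le_less_trans by blast
  qed
  then show ?thesis by (rule Cauchy_convergent)
qed

text \<open>The root is \<open>1 - Y\<close> for the limit Y of the iteration. The bound on
  \<open>id_blinfun - C\<close> encodes positivity. The commutation clause passes to the limit from
  the iterates; it makes the roots of \<open>R\<close> and \<open>1 - R\<close> commute and enters
  the uniqueness proof.\<close>

lemma sqrt_one_minus:
  fixes X :: "'a::chilbert_space \<Rightarrow>\<^sub>L 'a"
  assumes X: "selfadjoint_blinfun X" "norm X \<le> 1"
  obtains C where "selfadjoint_blinfun C" "norm (id_blinfun - C) \<le> 1" "\<forall>x. C (C x) = x - X x"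
    "\<forall>T. (\<forall>x. blinfun_apply T (X x) = X (T x)) \<longrightarrow> (\<forall>x. T (C x) = C (T x))"
proof -
  obtain Y where Y: "sqrt_seq X \<longlonglongrightarrow> Y" using convergent_sqrt_seq[OF X(2)] convergent_def by blast
  have lim: "(\<lambda>n. sqrt_seq X n x) \<longlonglongrightarrow> Y x" for x by (rule blinfun.tendsto[OF Y tendsto_const])
  have bY: "selfadjoint_blinfun Y"
    unfolding selfadjoint_blinfun_def
  proof (intro allI)
    fix x y
    have "(\<lambda>n. cinner (sqrt_seq X n x) y) \<longlonglongrightarrow> cinner (Y x) y" "(\<lambda>n. cinner x (sqrt_seq X n y)) \<longlonglongrightarrow> cinner x (Y y)"
      by (intro tendsto_intros lim)+
    then show "cinner (Y x) y = cinner x (Y y)"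
      using selfadjoint_blinfunD[OF selfadjoint_blinfun_sqrt_seq[OF X(1)]] LIMSEQ_unique by fastforce
  qed
  have nY: "norm Y \<le> 1"
    by (rule LIMSEQ_le_const2[OF tendsto_norm[OF Y]])
      (use norm_sqrt_seq[OF X(2)] sqrt_major_bounds order_trans in blast)
  have YY: "2 *\<^sub>R Y x = X x + Y (Y x)" for x
  proof -
    have "(\<lambda>n. 2 *\<^sub>R sqrt_seq X (Suc n) x) \<longlonglongrightarrow> 2 *\<^sub>R Y x"
      by (intro tendsto_scaleR tendsto_const LIMSEQ_Suc[OF lim])
    moreover have "(\<lambda>n. X x + sqrt_seq X n (sqrt_seq X n x)) \<longlonglongrightarrow> X x + Y (Y x)"
      by (intro tendsto_intros blinfun.tendsto[OF Y] lim)
    moreover have "2 *\<^sub>R sqrt_seq X (Suc n) x = X x + sqrt_seq X n (sqrt_seq X n x)" for n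
      by (simp add: blinfun.scaleR_left blinfun.add_left)
    ultimately show ?thesis using LIMSEQ_unique by (metis (no_types, lifting) ext)
  qed
  have comm: "T (Y x) = Y (T x)" if "\<And>x. T (X x) = X (T x)" for T :: "'a \<Rightarrow>\<^sub>L 'a" and x
  proof -
    have "(\<lambda>n. T (sqrt_seq X n x)) \<longlonglongrightarrow> T (Y x)" by (intro blinfun.tendsto tendsto_const lim)
    then show ?thesis unfolding sqrt_seq_commute[OF that] by (rule LIMSEQ_unique[OF _ lim])
  qed
  show thesis
  proof
    show "selfadjoint_blinfun (id_blinfun - Y)"
      using bY by (simp add: selfadjoint_blinfun_def blinfun.diff_left cinner_simps)
    show "norm (id_blinfun - (id_blinfun - Y)) \<le> 1" using nY by simp
    show "\<forall>x. (id_blinfun - Y) ((id_blinfun - Y) x) = x - X x"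
      using YY by (simp add: blinfun.diff_left blinfun.diff_right scaleR_2 algebra_simps)
    show "\<forall>T. (\<forall>x. blinfun_apply T (X x) = X (T x)) \<longrightarrow>
        (\<forall>x. T ((id_blinfun - Y) x) = (id_blinfun - Y) (T x))"
      using comm by (simp add: blinfun.diff_left blinfun.diff_right)
  qed
qed

section \<open>Positivity of bounded operators, and square roots of unbounded ones\<close>

lemma norm_blinfun_contraction: "norm T \<le> 1 \<Longrightarrow> norm (blinfun_apply T x) \<le> norm x"
  using norm_blinfun[of T x] mult_right_mono[of "norm T" 1 "norm x"] by simp

lemma pos_if_norm_id_minus_le_one:
  assumes "norm (id_blinfun - (C :: 'a::complex_inner \<Rightarrow>\<^sub>L 'a)) \<le> 1"
  shows "0 \<le> Re (cinner x (C x))"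
proof -
  have "Re (cinner x ((id_blinfun - C) x)) \<le> norm x * norm ((id_blinfun - C) x)"
    by (rule Re_cinner_le)
  also have "\<dots> \<le> norm x * norm x"
    using norm_blinfun_contraction[OF assms] by (intro mult_left_mono) auto
  finally show ?thesis
    by (simp add: blinfun.diff_left cinner_diff_right cinner_self power2_eq_square)
qed

text \<open>At \<open>y\<close> the form of \<open>T\<close> attains its minimum 0, so its first
  variation in the direction \<open>T y\<close>, which is \<open>2 * (norm (T y))^2\<close> up to
  sign, must vanish.\<close>

lemma selfadjoint_blinfun_pos_eq_zero:
  assumes T: "selfadjoint_blinfun T" and pos: "\<And>x. 0 \<le> Re (cinner x (T x))" and y: "Re (cinner y (T y)) = 0"
  shows "T y = 0"
proof -
  let ?a = "Re (cinner (T y) (T (T y)))"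
  have "t * (2 * (norm (T y))\<^sup>2) \<le> t\<^sup>2 * ?a" for t :: real
  proof -
    have "0 \<le> Re (cinner (y - t *\<^sub>R T y) (T (y - t *\<^sub>R T y)))" by (rule pos)
    also have "\<dots> = - (t * (Re (cinner y (T (T y))) + Re (cinner (T y) (T y)))) + t\<^sup>2 * ?a"
      by (simp add: blinfun.diff_right blinfun.scaleR_right cinner_simps y power2_eq_square algebra_simps)
    finally show ?thesis unfolding selfadjoint_blinfunD[OF T, of y "T y", symmetric] by (simp add: cinner_self)
  qed
  then have "2 * (norm (T y))\<^sup>2 = 0" by (rule quadratic_bound_zero)
  then show ?thesis by simp
qed

text \<open>This is the graph of \<open>Z C^(-1)\<close>, written without an inverse. Since
  \<open>C^2 + Z^2 = 1\<close>, the map from \<open>x\<close> to \<open>(C x, Z x)\<close> is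
  isometric, and its range is described by the equation \<open>Z f = C g\<close>, which is also the
  condition for belonging to the adjoint.\<close>

lemma selfadjoint_range:
  fixes C Z :: "'a::chilbert_space \<Rightarrow>\<^sub>L 'a"
  assumes C: "selfadjoint_blinfun C" and Z: "selfadjoint_blinfun Z" and comm: "\<And>x. C (Z x) = Z (C x)"
    and one: "\<And>x. C (C x) + Z (Z x) = x" and inj: "\<And>x. C x = 0 \<Longrightarrow> x = 0"
  shows "selfadjoint (range (\<lambda>x. (C x, Z x)))" "closure (range C) = UNIV"
proof -
  let ?S = "range (\<lambda>x. (C x, Z x))"
  have "csubspace (range C)"
    unfolding csubspace_def
    by (auto simp: selfadjoint_blinfun_scaleC[OF C, symmetric] simp flip: blinfun.add_right intro: range_eqI[where x = 0])
  then show dense: "closure (range C) = UNIV"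
  proof (rule closure_eq_UNIV_iff_orthogonal)
    fix y assume y: "\<And>h. h \<in> range C \<Longrightarrow> cinner h y = 0"
    have "C y = 0" by (rule eq_if_cinner_eq) (use y in \<open>simp add: selfadjoint_blinfunD[OF C, symmetric]\<close>)
    then show "y = 0" by (rule inj)
  qed
  have "csubspace ?S"
    unfolding csubspace_def
    by (auto simp: scaleC_prod_def selfadjoint_blinfun_scaleC[OF C, symmetric] selfadjoint_blinfun_scaleC[OF Z, symmetric]
        zero_prod_def blinfun.zero_right simp flip: blinfun.add_right intro: range_eqI[where x = 0])
  then have "linear_op ?S"
    proof (rule linear_opI)
    fix g assume "(0, g) \<in> ?S"
    then obtain x where "C x = 0" "g = Z x" by auto
    then show "g = 0" using inj[of x] by (simp add: blinfun.zero_right)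
  qed
  moreover have "densely_defined ?S"
    unfolding densely_defined_def using dense by (simp add: Domain_fst image_image)
  moreover have "adjoint_op ?S = ?S"
  proof (intro equalityI subsetI)
    fix z assume "z \<in> adjoint_op ?S"
    then obtain f g where z: "z = (f, g)" "(f, g) \<in> adjoint_op ?S" by (cases z) auto
    have "cinner x (Z f) = cinner x (C g)" for x
      using adjointD[OF z(2), of "C x" "Z x"] selfadjoint_blinfunD[OF C] selfadjoint_blinfunD[OF Z] cinner_commute
      by (metis rangeI)
    then have "Z f = C g" by (rule eq_if_cinner_eq)
    \<comment> \<open>The adjoint of the isometry, applied to \<open>(f, g)\<close>, recovers the
      parameter.\<close>
    let ?x = "C f + Z g"
    have "C ?x = C (C f) + Z (C g)" by (simp add: blinfun.add_right comm)
    also have "\<dots> = f" unfolding \<open>Z f = C g\<close>[symmetric] by (rule one)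
    finally have "C ?x = f" .
    have "Z ?x = C (Z f) + Z (Z g)" by (simp add: blinfun.add_right comm)
    also have "\<dots> = g" unfolding \<open>Z f = C g\<close> by (rule one)
    finally have "Z ?x = g" .
    with \<open>C ?x = f\<close> have "z = (C ?x, Z ?x)" unfolding z(1) by simp
    then show "z \<in> ?S" by (rule range_eqI)
  next
    fix z assume "z \<in> ?S"
    then obtain x where z: "z = (C x, Z x)" by blast
    show "z \<in> adjoint_op ?S"
      unfolding z by (rule adjointI) (auto simp: selfadjoint_blinfunD[OF C] selfadjoint_blinfunD[OF Z] comm)
  qed
  ultimately show "selfadjoint ?S" unfolding selfadjoint_def by (intro conjI)
qed

text \<open>Since \<open>B = (1 - R) R^(-1)\<close>, its root should be \<open>Z C^(-1)\<close>. For
  uniqueness, a root S' gives a bounded positive operator \<open>T = S' R\<close> with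
  \<open>T^2 = R (1 - R)\<close>; it must equal \<open>Z C\<close>, and then S' is contained in
  S.\<close>

lemma sqrt_exists_unique:
  fixes B :: "'a::chilbert_space lop"
  assumes B: "selfadjoint B" "nonneg_op B"
  shows "\<exists>!S. selfadjoint S \<and> nonneg_op S \<and> S O S = B"
proof -
  obtain R :: "'a \<Rightarrow>\<^sub>L 'a" where R: "selfadjoint_blinfun R" "norm R \<le> 1" "norm (id_blinfun - R) \<le> 1"
    and BR: "B = range (\<lambda>x. (R x, x - R x))"
    using resolvent_exists[OF B] .
  note linB = linear_opD[OF selfadjointD(1)[OF B(1)]]
  have R_B: "(R x, x - R x) \<in> B" for x unfolding BR by blast
  have R_eq: "R (f + g) = f" if "(f, g) \<in> B" for f g using that unfolding BR by auto
  have injR: "x = 0" if "R x = 0" for x using R_B[of x] linB(6)[OF linB(1), of x] that by simp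
  have saR: "selfadjoint_blinfun (id_blinfun - R)"
    using R(1) by (simp add: selfadjoint_blinfun_def blinfun.diff_left cinner_simps)
  obtain C where C: "selfadjoint_blinfun C" "norm (id_blinfun - C) \<le> 1" "\<forall>x. C (C x) = x - (id_blinfun - R) x"
      "\<forall>T. (\<forall>x. blinfun_apply T ((id_blinfun - R) x) = (id_blinfun - R) (T x)) \<longrightarrow>
        (\<forall>x. T (C x) = C (T x))"
    using sqrt_one_minus[OF saR R(3)] .
  have CC: "C (C x) = R x" for x using C(3) by (simp add: blinfun.diff_left)
  have commC: "T (C x) = C (T x)" if "\<And>x. T (R x) = R (T x)" for T :: "'a \<Rightarrow>\<^sub>L 'a" and x
    using that by (intro C(4)[rule_format]) (simp add: blinfun.diff_left blinfun.diff_right)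
  obtain Z where Z: "selfadjoint_blinfun Z" "norm (id_blinfun - Z) \<le> 1" "\<forall>x. Z (Z x) = x - R x"
    and commZ': "\<forall>T. (\<forall>x. blinfun_apply T (R x) = R (T x)) \<longrightarrow> (\<forall>x. T (Z x) = Z (T x))"
    using sqrt_one_minus[OF R(1,2)] .
  have ZZ: "Z (Z x) = x - R x" for x using Z(3) by simp
  have commZ: "T (Z x) = Z (T x)" if "\<And>x. T (R x) = R (T x)" for T :: "'a \<Rightarrow>\<^sub>L 'a" and x
    using that by (intro commZ'[rule_format])
  have comm: "C (Z x) = Z (C x)" for x by (rule commZ) (simp add: CC[symmetric])
  have injC: "x = 0" if "C x = 0" for x using injR[of x] CC[of x] that by (simp add: blinfun.zero_right)
  have one: "C (C x) + Z (Z x) = x" for x by (simp add: CC ZZ)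
  \<comment> \<open>A further root \<open>Y\<close> of \<open>Z\<close> is taken only to see that
    the product of the commuting positive operators \<open>Z\<close> and \<open>C\<close> is
    positive: its form at \<open>x\<close> is that of \<open>C\<close> at
    \<open>Y x\<close>.\<close>
  have saZ: "selfadjoint_blinfun (id_blinfun - Z)"
    using Z(1) by (simp add: selfadjoint_blinfun_def blinfun.diff_left cinner_simps)
  obtain Y where Y: "selfadjoint_blinfun Y" "norm (id_blinfun - Y) \<le> 1" "\<forall>x. Y (Y x) = x - (id_blinfun - Z) x"
      "\<forall>T. (\<forall>x. blinfun_apply T ((id_blinfun - Z) x) = (id_blinfun - Z) (T x)) \<longrightarrow>
        (\<forall>x. T (Y x) = Y (T x))"
    using sqrt_one_minus[OF saZ Z(2)] .
  have YY: "Y (Y x) = Z x" for x using Y(3) by (simp add: blinfun.diff_left)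
  have commY: "C (Y x) = Y (C x)" for x
    by (rule Y(4)[rule_format]) (simp add: blinfun.diff_left blinfun.diff_right comm)
  have ZC_pos: "0 \<le> Re (cinner x (Z (C x)))" for x
  proof -
    have "cinner x (Z (C x)) = cinner (Y x) (C (Y x))"
      by (simp add: YY[symmetric] commY selfadjoint_blinfunD[OF Y(1)])
    then show ?thesis using pos_if_norm_id_minus_le_one[OF C(2)] by simp
  qed
  define S where "S = range (\<lambda>x. (C x, Z x))"
  have S_I: "(C x, Z x) \<in> S" for x unfolding S_def by simp
  have S: "selfadjoint S" and dense: "closure (range C) = UNIV"
    unfolding S_def using selfadjoint_range[OF C(1) Z(1) comm one injC] by blast+
  have "nonneg_op S"
  proof (rule nonneg_opI[OF selfadjointD(1)[OF S]])
    fix f g assume fg: "(f, g) \<in> S"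
    then obtain x where "f = C x" "g = Z x" unfolding S_def by blast
    then have "0 \<le> Re (cinner f g)" using ZC_pos[of x] by (simp add: selfadjoint_blinfunD[OF C(1)] comm)
    moreover have "Im (cinner f g) = 0"
      using selfadjointD(4)[OF S fg fg] Im_cinner_commute[of f g] by simp
    ultimately show "Im (cinner f g) = 0 \<and> 0 \<le> Re (cinner f g)" by simp
  qed
  moreover have "S O S = B"
  proof (intro equalityI subsetI)
    fix z assume "z \<in> S O S"
    then obtain x y where z: "z = (C x, Z y)" "Z x = C y" unfolding S_def by auto
    let ?w = "C x + Z y"
    have "R ?w = C (C (C x)) + Z (C (C y))" by (simp add: CC[symmetric] blinfun.add_right comm)
    also have "\<dots> = C x" unfolding z(2)[symmetric] comm by (rule one)
    finally have "z = (R ?w, ?w - R ?w)" using z(1) by simp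
    then show "z \<in> B" unfolding BR by blast
  next
    fix z assume "z \<in> B"
    then obtain x where z: "z = (R x, x - R x)" unfolding BR by blast
    have "(R x, Z (C x)) \<in> S" using S_I[of "C x"] by (simp add: CC)
    moreover have "(Z (C x), x - R x) \<in> S" using S_I[of "Z x"] by (simp add: ZZ comm)
    ultimately show "z \<in> S O S" unfolding z by (rule relcompI)
  qed
  moreover have "S' = S" if S': "selfadjoint S'" "nonneg_op S'" "S' O S' = B" for S'
  proof -
    note lin = linear_opD[OF selfadjointD(1)[OF S'(1)]] and sym = selfadjointD(4)[OF S'(1)]
    have pos: "0 \<le> Re (cinner f g)" if "(f, g) \<in> S'" for f g
      using nonneg_opD(2)[OF selfadjointD(1)[OF S'(1)] S'(2) that] .
    \<comment> \<open>The range of \<open>R\<close> is the domain of the square of S', so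
      \<open>S' R\<close> is defined everywhere.\<close>
    have "\<exists>t. (R x, t) \<in> S' \<and> (t, x - R x) \<in> S'" for x
      using R_B[of x] unfolding S'(3)[symmetric] by blast
    then obtain t where t: "\<And>x. (R x, t x) \<in> S'" "\<And>x. (t x, x - R x) \<in> S'" by metis
    have t_eq: "t x = y" if "(R x, y) \<in> S'" for x y using lin(6)[OF t(1) that] .
    have "bounded_linear t"
    proof (rule bounded_linear_intro[where K = 1])
      show "t (x + y) = t x + t y" for x y
        using lin(2)[OF t(1)[of x] t(1)[of y]] by (intro t_eq) (simp add: blinfun.add_right)
      show "t (c *\<^sub>R x) = c *\<^sub>R t x" for c x
        using lin(5)[OF t(1)[of x], of c] by (intro t_eq) (simp add: blinfun.scaleR_right)
      show "norm (t x) \<le> norm x * 1" for x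
      proof -
        have "(norm (t x))\<^sup>2 = Re (cinner (R x) (x - R x))"
          using sym[OF t(1) t(2), of x x] by (simp add: cinner_self)
        also have "\<dots> \<le> norm (R x) * norm ((id_blinfun - R) x)"
          using Re_cinner_le[of "R x" "x - R x"] by (simp add: blinfun.diff_left)
        also have "\<dots> \<le> norm x * norm x"
          by (rule mult_mono[OF norm_blinfun_contraction[OF R(2)] norm_blinfun_contraction[OF R(3)]])
            simp_all
        finally have "(norm (t x))\<^sup>2 \<le> (norm x)\<^sup>2" by (simp only: power2_eq_square)
        then show ?thesis by (auto intro: power2_le_imp_le)
      qed
    qed
    then have T': "blinfun_apply (Blinfun t) = t" by (rule bounded_linear_Blinfun_apply)
    define T where "T = Blinfun t"
    have T: "T x = t x" for x unfolding T_def T' ..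
    note T_S = t[folded T] and T_eq = t_eq[folded T]
    have commT: "T (R x) = R (T x)" for x
    proof -
      have "(R x - R (R x), T x - T (R x)) \<in> S'" by (rule lin(4)[OF T_S(1) T_S(1)])
      then have "(T (R x), T x - T (R x)) \<in> B"
        using T_S(2)[of "R x"] unfolding S'(3)[symmetric] by blast
      from R_eq[OF this] show ?thesis by simp
    qed
    have TT: "T (T x) = R (x - R x)" for x
    proof (rule T_eq)
      show "(R (T x), R (x - R x)) \<in> S'"
        using T_S(2)[of "R x"] unfolding commT by (simp add: blinfun.diff_right)
    qed
    have "selfadjoint_blinfun T"
      unfolding selfadjoint_blinfun_def
    proof (intro allI)
      fix x y
      have "cinner (T x) (R y + (y - R y)) = cinner (R x + (x - R x)) (T y)"
        unfolding cinner_add_left cinner_add_right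
        using sym[OF T_S(1)[of x] T_S(1)[of y]] sym[OF T_S(2)[of x] T_S(2)[of y]] by simp
      then show "cinner (T x) y = cinner x (T y)" by simp
    qed
    have T_pos: "0 \<le> Re (cinner x (T x))" for x
    proof -
      have "Re (cinner (R x + (x - R x)) (T x)) = Re (cinner (R x) (T x)) + Re (cinner (T x) (x - R x))"
        unfolding cinner_add_left by (simp add: Re_cinner_commute[of "x - R x"])
      then show ?thesis using pos[OF T_S(1)[of x]] pos[OF T_S(2)[of x]] by simp
    qed
    \<comment> \<open>The counterpart of \<open>T\<close> for the constructed root: S maps
      \<open>R x = C (C x)\<close> to \<open>Z (C x)\<close>.\<close>
    define W where "W = Z o\<^sub>L C"
    have W: "W x = Z (C x)" for x by (simp add: W_def)
    have WW: "W (W x) = R (x - R x)" for x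
    proof -
      have "W (W x) = Z (Z (C (C x)))" by (simp add: W comm)
      then show ?thesis by (simp add: CC ZZ blinfun.diff_right)
    qed
    have TW: "T (W x) = W (T x)" for x
      unfolding W using commC[of T] commZ[of T] commT by simp
    have saW: "selfadjoint_blinfun W" by (simp add: selfadjoint_blinfun_def W selfadjoint_blinfunD[OF Z(1)] selfadjoint_blinfunD[OF C(1)] comm)
    have TZC: "T x = W x" for x
    proof -
      \<comment> \<open>As \<open>T\<close> and \<open>W\<close> commute and have equal squares,
        \<open>T + W\<close> kills \<open>y\<close>. The two nonnegative forms then vanish at
        \<open>y\<close> separately, hence so do \<open>T y\<close> and \<open>W y\<close>, and
        \<open>cinner y y\<close> with them.\<close>
      define y where "y = T x - W x"
      have "T y + W y = 0" unfolding y_def by (simp add: blinfun.diff_right TT WW TW)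
      then have "Re (cinner y (T y + W y)) = 0" by simp
      then have sum0: "Re (cinner y (T y)) + Re (cinner y (W y)) = 0" by (simp add: cinner_add_right)
      have W_pos: "0 \<le> Re (cinner x (W x))" for x unfolding W by (rule ZC_pos)
      have "T y = 0"
        by (rule selfadjoint_blinfun_pos_eq_zero[OF \<open>selfadjoint_blinfun T\<close> T_pos]) (use sum0 T_pos[of y] W_pos[of y] in linarith)
      moreover have "W y = 0"
        by (rule selfadjoint_blinfun_pos_eq_zero[OF saW W_pos]) (use sum0 T_pos[of y] W_pos[of y] in linarith)
      moreover have "cinner y y = cinner x (T y) - cinner x (W y)"
        unfolding selfadjoint_blinfunD[OF \<open>selfadjoint_blinfun T\<close>, symmetric] selfadjoint_blinfunD[OF saW, symmetric] cinner_diff_left[symmetric]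
        by (simp add: y_def)
      ultimately have "cinner y y = 0" by simp
      then show ?thesis by (simp add: y_def)
    qed
    have "S' \<subseteq> S"
    proof
      fix z assume zS: "z \<in> S'"
      then obtain f g where z: "z = (f, g)" "(f, g) \<in> S'" by (cases z) auto
      have "Z f = C g"
      proof (rule eq_if_cinner_dense_eq[OF dense])
        fix c assume "c \<in> range C"
        then obtain x where c: "c = C x" by blast
        have "cinner (T x) f = cinner (R x) g" using sym[OF T_S(1) z(2), of x] by simp
        then have "cinner (Z c) f = cinner (C c) g" by (simp add: TZC W CC c)
        then show "cinner c (Z f) = cinner c (C g)" by (simp add: selfadjoint_blinfunD[OF Z(1)] selfadjoint_blinfunD[OF C(1)])
      qed
      have "(f, g) \<in> adjoint_op S"
        unfolding S_def
        by (rule adjointI) (auto simp: selfadjoint_blinfunD[OF Z(1), symmetric] selfadjoint_blinfunD[OF C(1), symmetric] \<open>Z f = C g\<close>)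
      then show "z \<in> S" using selfadjointD(3)[OF S] z(1) by simp
    qed
    \<comment> \<open>Taking adjoints reverses the inclusion, so a selfadjoint operator has no
      proper selfadjoint restriction.\<close>
    then have "adjoint_op S \<subseteq> adjoint_op S'" by (rule adjoint_antimono)
    then show ?thesis using \<open>S' \<subseteq> S\<close> selfadjointD(3)[OF S] selfadjointD(3)[OF S'(1)] by simp
  qed
  ultimately show ?thesis using S by (intro ex1I[where a = S] conjI) (assumption | elim conjE)+
qed

lemma sqrt_op_props:
  assumes "selfadjoint B" "nonneg_op B"
  shows "selfadjoint (sqrt_op B)" "nonneg_op (sqrt_op B)" "sqrt_op B O sqrt_op B = B"
  using theI'[OF sqrt_exists_unique[OF assms]] unfolding sqrt_op_def by blast+

text \<open>If \<open>K\<close> is represented by the form \<open>h \<mapsto> \<parallel>S h\<parallel>\<^sup>2\<close>, then that form is determined by the values of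
  \<open>K = S\<^sup>2\<close> alone: test with \<open>- (1 + \<epsilon> K)\<^sup>-\<^sup>1 h\<close>, which converges to \<open>- h\<close>.\<close>

lemma form_domain_sqrt:
  fixes S :: "'a::chilbert_space lop"
  assumes S: "selfadjoint S" and K: "selfadjoint (S O S)" "nonneg_op (S O S)"
    and h: "\<And>f k. (f, k) \<in> S O S \<Longrightarrow> 0 \<le> Re (cinner f k) + 2 * Re (cinner k h) + c"
  shows "\<exists>b. (h, b) \<in> S \<and> (norm b)\<^sup>2 \<le> c"
proof -
  note linK = linear_opD[OF selfadjointD(1)[OF K(1)]]
  note symS = selfadjointD(4)[OF S]
  have posK: "0 \<le> Re (cinner f g)" if "(f, g) \<in> S O S" for f g
    using nonneg_opD(2)[OF selfadjointD(1)[OF K(1)] K(2) that] .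
  have c: "0 \<le> c" using h[OF linK(1)] by simp
  have approx: "\<exists>f t. (f, t) \<in> S \<and> norm (f - h) \<le> \<delta> \<and> norm t \<le> sqrt c" if \<delta>: "0 < \<delta>" for \<delta>
  proof -
    have "h \<in> closure (Domain (S O S))"
      using selfadjointD(2)[OF K(1)] by (simp add: densely_defined_def)
    then obtain p where p: "p \<in> Domain (S O S)" "dist p h < \<delta> / 4"
      using \<delta> unfolding closure_approachable by (metis divide_pos_pos zero_less_numeral)
    then obtain k where pk: "(p, k) \<in> S O S" by blast
    \<comment> \<open>Chosen to make \<open>\<epsilon> * norm k\<close> at most
      \<open>\<delta> / 4\<close>; the summand 1 covers \<open>k = 0\<close>.\<close>
    define \<epsilon> where "\<epsilon> = \<delta> / (4 * (norm k + 1))"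
    have \<epsilon>: "0 < \<epsilon>" "\<epsilon> * norm k \<le> \<delta> / 4"
      using \<delta> norm_ge_zero[of k] unfolding \<epsilon>_def by (auto simp: divide_simps add_nonneg_pos)
    obtain f g where fg: "(f, g) \<in> S O S" "h = f + \<epsilon> *\<^sub>R g"
      using resolvent_surj[OF K \<epsilon>(1)] .
    then obtain t where t: "(f, t) \<in> S" "(t, g) \<in> S" by blast
    have "norm (f - p) \<le> norm ((f - p) + \<epsilon> *\<^sub>R (g - k))"
      using posK[OF linK(4)[OF fg(1) pk]] \<epsilon>(1) by (intro norm_le_norm_add) (simp add: cinner_scaleR_right)
    also have "(f - p) + \<epsilon> *\<^sub>R (g - k) = (h - p) - \<epsilon> *\<^sub>R k"
      unfolding fg(2) by (simp add: algebra_simps)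
    also have "norm \<dots> \<le> norm (h - p) + \<epsilon> * norm k"
      using norm_triangle_ineq4[of "h - p" "\<epsilon> *\<^sub>R k"] \<epsilon>(1) by simp
    finally have "norm (f - p) \<le> \<delta> / 4 + \<delta> / 4"
      using p(2) \<epsilon>(2) unfolding dist_norm norm_minus_commute[of p h] by linarith
    then have "norm (f - h) \<le> \<delta>"
      using norm_triangle_ineq[of "f - p" "p - h"] p(2) \<delta> unfolding dist_norm by simp
    moreover have "(norm t)\<^sup>2 \<le> c"
    proof -
      have tt: "cinner f g = (norm t)\<^sup>2" using symS[OF t] by (simp add: cinner_self)
      \<comment> \<open>Inserting \<open>h = f + \<epsilon> g\<close> leaves
        \<open>- (norm t)^2 - 2 \<epsilon> (norm g)^2 + c\<close>, hence the bound on
        \<open>t\<close>.\<close>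
      have "0 \<le> Re (cinner (- f) (- g)) + 2 * Re (cinner (- g) h) + c"
        using linK(4)[OF linK(1) fg(1)] by (intro h) simp
      then have "0 \<le> Re (cinner f g) - 2 * (Re (cinner g f) + \<epsilon> * (norm g)\<^sup>2) + c"
        unfolding fg(2) by (simp add: cinner_simps cinner_self)
      moreover have "Re (cinner g f) = Re (cinner f g)" by (rule Re_cinner_commute)
      moreover have "0 \<le> \<epsilon> * (norm g)\<^sup>2" using \<epsilon>(1) by simp
      ultimately show ?thesis unfolding tt by simp
    qed
    then have "norm t \<le> sqrt c" by (rule real_le_rsqrt)
    ultimately show ?thesis using t(1) by blast
  qed
  \<comment> \<open>The approximants \<open>f\<close> tend to \<open>h\<close> with images under S
    bounded by \<open>sqrt c\<close>. This passes to the functional of \<open>h\<close>, and its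
    representing vector puts \<open>h\<close> into the domain of the adjoint of S, which is
    S.\<close>
  have "cmod (cinner h s) \<le> sqrt c * norm p" if ps: "(p, s) \<in> S" for p s
  proof (rule field_le_epsilon)
    fix e :: real assume e: "0 < e"
    define \<delta> where "\<delta> = e / (norm s + 1)"
    have \<delta>: "0 < \<delta>" "\<delta> * norm s \<le> e"
      using e norm_ge_zero[of s] unfolding \<delta>_def by (auto simp: divide_simps add_nonneg_pos)
    obtain f t where ft: "(f, t) \<in> S" "norm (f - h) \<le> \<delta>" "norm t \<le> sqrt c" using approx[OF \<delta>(1)] by blast
    have "cinner h s = cinner t p - cinner (f - h) s"
      using symS[OF ft(1) ps] by (simp add: cinner_diff_left)
    then have "cmod (cinner h s) \<le> cmod (cinner t p) + cmod (cinner (f - h) s)"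
      by (simp add: norm_triangle_ineq4)
    also have "\<dots> \<le> norm t * norm p + norm (f - h) * norm s"
      by (intro add_mono cmod_cinner_le)
    also have "\<dots> \<le> sqrt c * norm p + \<delta> * norm s"
      using ft by (intro add_mono mult_right_mono) auto
    finally show "cmod (cinner h s) \<le> sqrt c * norm p + e" using \<delta>(2) by linarith
  qed
  then obtain b where b: "(h, b) \<in> adjoint_op S" "norm b \<le> sqrt c"
    using riesz_dense[OF selfadjointD(1,2)[OF S], of h "sqrt c"] c by auto
  have "(norm b)\<^sup>2 \<le> c" using power_mono[OF b(2), of 2] c by simp
  then show ?thesis using b(1) selfadjointD(3)[OF S] by auto
qed

text \<open>By polarisation, equal norms give equal inner products of images. The relation defining
  S (S f) therefore also says that the S'-image of \<open>f\<close> lies in the domain of the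
  adjoint of S', with the same value.\<close>

lemma form_determines:
  fixes S S' :: "'a::chilbert_space lop"
  assumes S: "selfadjoint S" and S': "selfadjoint S'" and dom: "Domain S = Domain S'"
    and norm: "\<And>f g g'. (f, g) \<in> S \<Longrightarrow> (f, g') \<in> S' \<Longrightarrow> norm g = norm g'"
  shows "S O S \<subseteq> S' O S'"
proof -
  note lin = linear_opD[OF selfadjointD(1)[OF S]] and lin' = linear_opD[OF selfadjointD(1)[OF S']]
  have Re_eq: "Re (cinner a b) = Re (cinner a' b')"
    if "(f, a) \<in> S" "(f, a') \<in> S'" "(g, b) \<in> S" "(g, b') \<in> S'" for f g a a' b b'
    using norm[OF lin(2)[OF that(1,3)] lin'(2)[OF that(2,4)]] norm[OF that(1,2)] norm[OF that(3,4)]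
      norm_add_sq[of a b] norm_add_sq[of a' b'] by simp
  \<comment> \<open>Replacing \<open>f\<close> by \<open>\<i> f\<close> turns equality of real parts
    into equality of imaginary parts.\<close>
  have eq: "cinner a b = cinner a' b'"
    if ab: "(f, a) \<in> S" "(f, a') \<in> S'" "(g, b) \<in> S" "(g, b') \<in> S'" for f g a a' b b'
    using Re_eq[OF ab] Re_eq[OF lin(3)[OF ab(1), of \<i>] lin'(3)[OF ab(2), of \<i>] ab(3,4)]
    by (simp add: complex_eq_iff cinner_scaleC_left)
  show ?thesis
  proof
    fix z assume "z \<in> S O S"
    then obtain f t k where z: "z = (f, k)" "(f, t) \<in> S" "(t, k) \<in> S" by auto
    obtain t' where t': "(f, t') \<in> S'" using z(2) dom by blast
    have "(t', k) \<in> adjoint_op S'"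
    proof (rule adjointI)
      fix g s' assume g: "(g, s') \<in> S'"
      then obtain s where s: "(g, s) \<in> S" using dom by blast
      show "cinner t' s' = cinner k g"
        using eq[OF z(2) t' s g] selfadjointD(4)[OF S z(3) s] by simp
    qed
    then show "z \<in> S' O S'" using z(1) t' selfadjointD(3)[OF S'] by auto
  qed
qed

section \<open>The operator associated with a closed form\<close>

context closed_form
begin

text \<open>The graph of \<open>R^(-1) - 1\<close>, parametrised so that injectivity of
  \<open>R\<close> can be proved afterwards.\<close>

definition form_op where "form_op = range (\<lambda>x. (R x, x - R x))"

lemma form_opE:
  assumes "(f, g) \<in> form_op"
  shows "f = R (f + g)" "f \<in> Q" "cinner f g = of_real (q f)"
    "h \<in> Q \<Longrightarrow> q f + 2 * Re (cinner (h - f) g) \<le> q h"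
proof -
  obtain x where "f = R x" "g = x - R x" using assms unfolding form_op_def by blast
  then show "f = R (f + g)" "f \<in> Q" "cinner f g = of_real (q f)"
    "h \<in> Q \<Longrightarrow> q f + 2 * Re (cinner (h - f) g) \<le> q h"
    using form_R[of x] form_lower_bound[of h x] by simp_all
qed

text \<open>By \<open>form_R\<close> the diagonal values \<open>cinner (R x) x\<close> are real, so
  the defect of symmetry \<open>b\<close> vanishes on the diagonal; polarising with \<open>y\<close>
  and \<open>\<i> y\<close> removes it everywhere.\<close>

lemma R_symmetric: "cinner (R x) y = cinner x (R y)"
proof -
  define b where "b x y = cinner (R x) y - cinner x (R y)" for x y
  have diag: "b x x = 0" for x
  proof -
    have "cinner (R x) x = of_real (q (R x)) + cinner (R x) (R x)"
      using form_R[of x] by (simp add: cinner_diff_right diff_eq_eq)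
    then have "cnj (cinner (R x) x) = cinner (R x) x" by (simp add: cinner_self)
    then show ?thesis unfolding b_def using cinner_commute[of x "R x"] by simp
  qed
  have 1: "b x y + b y x = 0" for x y
  proof -
    have "b x y + b y x = b (x + y) (x + y) - b x x - b y y"
      unfolding b_def by (simp add: R_add cinner_simps algebra_simps)
    then show ?thesis by (simp add: diag)
  qed
  have "b x (\<i> *\<^sub>C y) + b (\<i> *\<^sub>C y) x = \<i> * (b x y - b y x)"
    unfolding b_def by (simp add: R_scaleC cinner_simps algebra_simps)
  then have "b x y - b y x = 0" using 1[of x "\<i> *\<^sub>C y"] by simp
  with 1[of x y] have "b x y = 0" by (simp add: complex_eq_iff)
  then show ?thesis unfolding b_def by simp
qed

text \<open>Density of \<open>Q\<close> makes \<open>R\<close> injective: if \<open>R x = 0\<close>,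
  then 0 minimises the energy at \<open>x\<close> and the first variation shows \<open>x\<close>
  orthogonal to \<open>Q\<close>. Symmetry of \<open>R\<close> turns injectivity into density of its
  range and the adjoint relation into \<open>f = R (f + g)\<close>.\<close>

lemma selfadjoint_form_op:
  assumes dense: "closure Q = UNIV"
  shows "selfadjoint form_op" "nonneg_op form_op"
proof -
  have q0: "q 0 = 0" using scale[OF Q(1), of 0] by simp
  have inj: "x = 0" if x: "R x = 0" for x
  proof -
    have Re0: "Re (cinner h x) = 0" if h: "h \<in> Q" for h
    proof -
      have "t * (2 * Re (cinner h x)) \<le> t\<^sup>2 * q h" for t
        using form_lower_bound[OF Q(4)[OF h, of t], of x] x q0 scaleR[OF h, of t]
        by (simp add: cinner_scaleR_left)
      then have "2 * Re (cinner h x) = 0" by (rule quadratic_bound_zero)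
      then show ?thesis by simp
    qed
    show ?thesis
    proof (rule eq_if_cinner_dense_eq[OF dense])
      fix h assume h: "h \<in> Q"
      show "cinner h x = cinner h 0"
        using Re0[OF h] Re0[OF Q(3)[OF h, of \<i>]] by (simp add: complex_eq_iff cinner_scaleC_left)
    qed
  qed
  have sub: "csubspace form_op"
    unfolding csubspace_def
  proof (intro conjI ballI allI)
    have I: "(R x, x - R x) \<in> form_op" for x unfolding form_op_def by simp
    have "R 0 = 0" using R_scaleC[of 0 0] by simp
    then show "0 \<in> form_op" using I[of 0] by (simp add: zero_prod_def)
    fix z assume "z \<in> form_op"
    then obtain x where z: "z = (R x, x - R x)" unfolding form_op_def by blast
    show "c *\<^sub>C z \<in> form_op" for c
      using I[of "c *\<^sub>C x"] unfolding z by (simp add: scaleC_prod_def R_scaleC scaleC_diff_right)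
    fix w assume "w \<in> form_op"
    then obtain y where w: "w = (R y, y - R y)" unfolding form_op_def by blast
    show "z + w \<in> form_op"
      using I[of "x + y"] unfolding z w by (simp add: R_add add_diff_add)
  qed
  have lin: "linear_op form_op"
  proof (rule linear_opI[OF sub])
    fix g assume "(0, g) \<in> form_op"
    then show "g = 0" using form_opE(1)[of 0 g] inj[of g] by simp
  qed
  moreover have "densely_defined form_op"
    unfolding densely_defined_def
  proof (rule closure_eq_UNIV_iff_orthogonal[OF csubspace_Domain[OF lin]])
    fix y assume y: "\<And>h. h \<in> Domain form_op \<Longrightarrow> cinner h y = 0"
    have "cinner (R x) y = 0" for x
    proof (rule y)
      have "(R x, x - R x) \<in> form_op" unfolding form_op_def by simp
      then show "R x \<in> Domain form_op" by (rule DomainI)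
    qed
    then have "cinner x (R y) = cinner x 0" for x by (simp add: R_symmetric)
    then have "R y = 0" by (rule eq_if_cinner_eq)
    then show "y = 0" by (rule inj)
  qed
  moreover have "adjoint_op form_op = form_op"
  proof (intro equalityI subsetI)
    fix z assume "z \<in> adjoint_op form_op"
    then obtain f g where z: "z = (f, g)" "(f, g) \<in> adjoint_op form_op" by (cases z) auto
    have "f = R (f + g)"
    proof (rule eq_if_cinner_eq)
      fix x
      have "cinner f (x - R x) = cinner g (R x)"
        by (rule adjointD[OF z(2)]) (simp add: form_op_def)
      then have "cinner f x = cinner (R (f + g)) x"
        by (simp add: R_symmetric cinner_simps diff_eq_eq add.commute)
      then show "cinner x f = cinner x (R (f + g))" by (metis cinner_commute)
    qed
    then have "z = (R (f + g), (f + g) - R (f + g))" using z(1) by simp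
    then show "z \<in> form_op" unfolding form_op_def by (rule range_eqI)
  next
    fix z assume "z \<in> form_op"
    then obtain y where z: "z = (R y, y - R y)" unfolding form_op_def by blast
    show "z \<in> adjoint_op form_op"
      unfolding z
    proof (rule adjointI)
      fix f k assume "(f, k) \<in> form_op"
      then obtain x where "f = R x" "k = x - R x" unfolding form_op_def by blast
      then show "cinner (R y) k = cinner (y - R y) f"
        by (simp add: R_symmetric cinner_simps)
    qed
  qed
  ultimately show "selfadjoint form_op" unfolding selfadjoint_def by (intro conjI)
  show "nonneg_op form_op"
    by (rule nonneg_opI[OF lin]) (simp add: form_opE(3) nonneg form_opE(2))
qed

end

section \<open>The Krein--von Neumann extension\<close>

lemma nonneg_selfadjoint_extensionD:
  assumes "nonneg_selfadjoint_extension V B"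
  shows "selfadjoint B" "nonneg_op B" "V \<subseteq> B"
  using assms unfolding nonneg_selfadjoint_extension_def by simp_all

lemma op_leD:
  assumes "op_le B C"
  shows "Domain (sqrt_op C) \<subseteq> Domain (sqrt_op B)"
    "f \<in> Domain (sqrt_op C) \<Longrightarrow> norm (sqrt_op B \<cdot>\<^sub>o f) \<le> norm (sqrt_op C \<cdot>\<^sub>o f)"
  using assms unfolding op_le_def by simp_all

section \<open>The Ando-Nishio form of a nonnegative symmetric operator\<close>

locale nonneg_symmetric =
  fixes V :: "'a::chilbert_space lop"
  assumes linear: "linear_op V" and dense: "densely_defined V"
    and symmetric: "V \<subseteq> adjoint_op V"
    and pos: "(f, k) \<in> V \<Longrightarrow> 0 \<le> Re (cinner f k)"
begin

lemmas lin = linear_opD[OF linear]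

lemma sym: "(f, k) \<in> V \<Longrightarrow> (g, l) \<in> V \<Longrightarrow> cinner f l = cinner k g"
  using symmetric adjointD by blast

text \<open>\<open>form_le h c\<close> says that the Ando--Nishio form
  \<open>sup\<^sub>f (- \<langle>f, V f\<rangle> - 2 Re \<langle>V f, h\<rangle>)\<close> of \<open>V\<close> at \<open>h\<close> is at most \<open>c\<close>.\<close>

definition form_le where
  "form_le h c \<longleftrightarrow> (\<forall>(f, k)\<in>V. 0 \<le> Re (cinner f k) + 2 * Re (cinner k h) + c)"

definition form_dom where "form_dom = {h. \<exists>c. form_le h c}"

text \<open>The least upper bound as an infimum of bounds. It carries meaning only on
  \<open>form_dom\<close>; elsewhere the set is empty.\<close>

definition form where "form h = Inf {c. form_le h c}"

lemma form_leD: "form_le h c \<Longrightarrow> (f, k) \<in> V \<Longrightarrow> 0 \<le> Re (cinner f k) + 2 * Re (cinner k h) + c"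
  unfolding form_le_def by blast

lemma form_leI: "(\<And>f k. (f, k) \<in> V \<Longrightarrow> 0 \<le> Re (cinner f k) + 2 * Re (cinner k h) + c) \<Longrightarrow> form_le h c"
  unfolding form_le_def by blast

lemma form_le_nonneg: "form_le h c \<Longrightarrow> 0 \<le> c"
  using form_leD[OF _ lin(1)] by force

lemma form_le_form: "h \<in> form_dom \<Longrightarrow> form_le h (form h)"
proof (rule form_leI)
  fix f k assume h: "h \<in> form_dom" and fk: "(f, k) \<in> V"
  have "- Re (cinner f k) - 2 * Re (cinner k h) \<le> form h"
    unfolding form_def
  proof (rule cInf_greatest)
    show "{c. form_le h c} \<noteq> {}" using h unfolding form_dom_def by simp
    show "- Re (cinner f k) - 2 * Re (cinner k h) \<le> c" if "c \<in> {c. form_le h c}" for c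
      using form_leD[OF _ fk, of h c] that by simp
  qed
  then show "0 \<le> Re (cinner f k) + 2 * Re (cinner k h) + form h" by simp
qed

lemma form_leE:
  assumes "form_le h c"
  shows "h \<in> form_dom" "form h \<le> c"
proof -
  show "h \<in> form_dom" using assms unfolding form_dom_def by blast
  show "form h \<le> c"
    unfolding form_def
    by (rule cInf_lower) (use assms form_le_nonneg in \<open>auto intro: bdd_belowI[of _ 0]\<close>)
qed

lemma form_le_zero: "form_le 0 0"
  by (rule form_leI) (simp add: pos)

lemma form_le_scale:
  assumes "form_le h c"
  shows "form_le (a *\<^sub>C h) ((cmod a)\<^sup>2 * c)"
proof (cases "a = 0")
  case False
  show ?thesis
  proof (rule form_leI)
    fix f k assume fk: "(f, k) \<in> V"
    define f' k' where "f' = (1/a) *\<^sub>C f" and "k' = (1/a) *\<^sub>C k"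
    then have eqs: "a *\<^sub>C f' = f" "a *\<^sub>C k' = k" using False by (simp_all add: scaleC_scaleC)
    have fk': "(f', k') \<in> V" unfolding f'_def k'_def by (rule lin(3)[OF fk])
    have "a * (cnj a * z) = of_real ((cmod a)\<^sup>2) * z" for z
      by (simp add: complex_norm_square algebra_simps del: of_real_power)
    then have scal: "cinner (a *\<^sub>C u) (a *\<^sub>C v) = of_real ((cmod a)\<^sup>2) * cinner u v" for u v :: 'a
      by (simp only: cinner_scaleC_left cinner_scaleC_right)
    have "0 \<le> (cmod a)\<^sup>2 * (Re (cinner f' k') + 2 * Re (cinner k' h) + c)"
      using form_leD[OF assms fk'] by simp
    also have "\<dots> = Re (cinner (a *\<^sub>C f') (a *\<^sub>C k')) + 2 * Re (cinner (a *\<^sub>C k') (a *\<^sub>C h)) + (cmod a)\<^sup>2 * c"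
      unfolding scal by (simp add: algebra_simps del: of_real_power)
    finally show "0 \<le> Re (cinner f k) + 2 * Re (cinner k (a *\<^sub>C h)) + (cmod a)\<^sup>2 * c"
      unfolding eqs .
  qed
qed (simp add: form_le_zero)

text \<open>Test the bound at \<open>h1\<close> with \<open>(f1 + f2) / 2\<close> and the one at
  \<open>h2\<close> with \<open>(f1 - f2) / 2\<close>. In the sum the mixed terms cancel, leaving
  \<open>f1\<close> and \<open>f2\<close> independent.\<close>

lemma form_le_parallelogram:
  assumes 1: "form_le h1 c1" and 2: "form_le h2 c2" and f: "(f1, k1) \<in> V" "(f2, k2) \<in> V"
  shows "0 \<le> (Re (cinner f1 k1) + 2 * Re (cinner k1 (h1 + h2))) +
    (Re (cinner f2 k2) + 2 * Re (cinner k2 (h1 - h2))) + (2 * c1 + 2 * c2)"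
proof -
  let ?h = "\<lambda>v::'a. (1/2) *\<^sub>R v"
  have "0 \<le> Re (cinner (?h (f1 + f2)) (?h (k1 + k2))) + 2 * Re (cinner (?h (k1 + k2)) h1) + c1"
    by (intro form_leD[OF 1] lin f)
  moreover have "0 \<le> Re (cinner (?h (f1 - f2)) (?h (k1 - k2))) + 2 * Re (cinner (?h (k1 - k2)) h2) + c2"
    by (intro form_leD[OF 2] lin f)
  ultimately show ?thesis by (simp add: cinner_simps algebra_simps)
qed

lemma form_le_add:
  assumes 1: "form_le h1 c1" and 2: "form_le h2 c2"
  shows "form_le (h1 + h2) (2 * c1 + 2 * c2)"
  by (rule form_leI) (use form_le_parallelogram[OF 1 2 _ lin(1)] in simp)

text \<open>The independent test vectors allow two suprema in turn: over the one paired with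
  \<open>h1 + h2\<close> first, then over the one paired with \<open>h1 - h2\<close>.\<close>

lemma form_parallelogram:
  assumes "form_le h1 c1" "form_le h2 c2"
  shows "form (h1 + h2) + form (h1 - h2) \<le> 2 * c1 + 2 * c2"
proof -
  have "form_le (h1 - h2) (2 * c1 + 2 * c2 - form (h1 + h2))"
  proof (rule form_leI)
    fix f2 k2 assume 2: "(f2, k2) \<in> V"
    have "form_le (h1 + h2) (Re (cinner f2 k2) + 2 * Re (cinner k2 (h1 - h2)) + (2 * c1 + 2 * c2))"
      by (rule form_leI) (use form_le_parallelogram[OF assms _ 2] in \<open>simp add: add.assoc\<close>)
    from form_leE(2)[OF this]
    show "0 \<le> Re (cinner f2 k2) + 2 * Re (cinner k2 (h1 - h2)) + (2 * c1 + 2 * c2 - form (h1 + h2))"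
      by simp
  qed
  from form_leE(2)[OF this] show ?thesis by simp
qed

lemma form_eq_on_Domain:
  assumes "(f, k) \<in> V"
  shows "form_le f (Re (cinner f k))"
proof (rule form_leI)
  fix g l assume g: "(g, l) \<in> V"
  have "0 \<le> Re (cinner (g + f) (l + k))" by (rule pos[OF lin(2)[OF g assms]])
  also have "\<dots> = Re (cinner g l) + 2 * Re (cinner l f) + Re (cinner f k)"
    using sym[OF g assms] Re_cinner_commute[of f l] by (simp add: cinner_simps)
  finally show "0 \<le> Re (cinner g l) + 2 * Re (cinner l f) + Re (cinner f k)" .
qed

sublocale closed_form form_dom form
proof
  have dom: "form_le h (form h)" if "h \<in> form_dom" for h using form_le_form[OF that] .
  show "csubspace form_dom"
    unfolding csubspace_def
    by (intro conjI ballI allI)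
      (use form_leE(1) form_le_zero form_le_add[OF dom dom] form_le_scale[OF dom] in blast)+
  show "0 \<le> form x" if "x \<in> form_dom" for x using form_le_nonneg[OF dom[OF that]] .
  show "form (a *\<^sub>C x) = (cmod a)\<^sup>2 * form x" if x: "x \<in> form_dom" for a x
  proof (cases "a = 0")
    case True
    have "form 0 = 0"
      using form_leE(2)[OF form_le_zero] form_le_nonneg[OF dom[OF form_leE(1)[OF form_le_zero]]] by simp
    then show ?thesis using True by simp
  next
    case False
    have le: "form_le (a *\<^sub>C x) ((cmod a)\<^sup>2 * form x)" by (rule form_le_scale[OF dom[OF x]])
    \<comment> \<open>Scaling back by \<open>1 / a\<close> upgrades the inequality \<open>le\<close>
      to an equality.\<close>
    have "form_le ((1/a) *\<^sub>C a *\<^sub>C x) ((cmod (1/a))\<^sup>2 * form (a *\<^sub>C x))"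
      by (rule form_le_scale[OF dom[OF form_leE(1)[OF le]]])
    then have "form x \<le> (cmod (1/a))\<^sup>2 * form (a *\<^sub>C x)"
      using form_leE(2) False by (simp add: scaleC_scaleC)
    then have "(cmod a)\<^sup>2 * form x \<le> form (a *\<^sub>C x)"
      using False by (simp add: norm_divide power_divide field_simps)
    then show ?thesis using form_leE(2)[OF le] by simp
  qed
  show "form (x + y) + form (x - y) \<le> 2 * form x + 2 * form y" if "x \<in> form_dom" "y \<in> form_dom" for x y
    by (rule form_parallelogram[OF dom[OF that(1)] dom[OF that(2)]])
  show "x \<in> form_dom \<and> form x \<le> c"
    if h: "\<And>n. h n \<in> form_dom" "h \<longlonglongrightarrow> x" "\<And>n. form (h n) \<le> c" for h x c
  proof -
    \<comment> \<open>Each test vector gives a condition that is continuous in \<open>h\<close>; a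
      supremum of such functions is lower semicontinuous.\<close>
    have "form_le x c"
    proof (rule form_leI)
      fix f k assume fk: "(f, k) \<in> V"
      have "(\<lambda>n. Re (cinner f k) + 2 * Re (cinner k (h n)) + c) \<longlonglongrightarrow> Re (cinner f k) + 2 * Re (cinner k x) + c"
        by (intro tendsto_intros h)
      moreover have "0 \<le> Re (cinner f k) + 2 * Re (cinner k (h n)) + c" for n
        using form_leD[OF dom[OF h(1)] fk, of n] h(3)[of n] by simp
      ultimately show "0 \<le> Re (cinner f k) + 2 * Re (cinner k x) + c" by (auto intro: LIMSEQ_le_const)
    qed
    then show ?thesis using form_leE by blast
  qed
qed

text \<open>It suffices that \<open>f\<close> minimises the energy at \<open>f + k\<close>. Testing
  the form at \<open>h\<close> with \<open>(- f, - k)\<close> bounds it below by an affine function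
  of \<open>h\<close>, and the energy then exceeds that of \<open>f\<close> by at least
  \<open>(norm (h - f))^2\<close>.\<close>

lemma extends: "V \<subseteq> form_op"
proof
  fix z assume "z \<in> V"
  then obtain f k where z: "z = (f, k)" "(f, k) \<in> V" by (cases z) auto
  have neg: "(- f, - k) \<in> V" using lin(4)[OF lin(1) z(2)] by simp
  note f_le = form_leE[OF form_eq_on_Domain[OF z(2)]]
  have "minimiser (f + k) f"
    unfolding minimiser_def
  proof (intro conjI ballI)
    show "f \<in> form_dom" by (rule f_le)
    fix h assume h: "h \<in> form_dom"
    have "2 * Re (cinner k h) - Re (cinner f k) \<le> form h"
      using form_leD[OF form_le_form[OF h] neg] by simp
    moreover have "h - (f + k) = (h - f) - k" by simp
    then have "(norm (h - (f + k)))\<^sup>2 = (norm (h - f))\<^sup>2 - 2 * Re (cinner (h - f) k) + (norm k)\<^sup>2"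
      by (simp only: norm_diff_sq[of "h - f" k])
    moreover have "Re (cinner (h - f) k) = Re (cinner k h) - Re (cinner f k)"
      using Re_cinner_commute[of h k] by (simp add: cinner_diff_left)
    moreover have "0 \<le> (norm (h - f))\<^sup>2" "(norm (f - (f + k)))\<^sup>2 = (norm k)\<^sup>2" by simp_all
    ultimately show "energy f (f + k) \<le> energy h (f + k)" using f_le(2) unfolding energy_def by linarith
  qed
  then have "z = (R (f + k), (f + k) - R (f + k))" using R_eqI[of "f + k" f] z(1) by simp
  then show "z \<in> form_op" unfolding form_op_def by (rule range_eqI)
qed

lemma form_op_extension: "nonneg_selfadjoint_extension V form_op"
proof -
  have "Domain V \<subseteq> form_dom"
  proof
    fix f assume "f \<in> Domain V"
    then obtain k where "(f, k) \<in> V" by blast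
    then show "f \<in> form_dom" by (rule form_leE(1)[OF form_eq_on_Domain])
  qed
  then have "closure (Domain V) \<subseteq> closure form_dom" by (rule closure_mono)
  then have "UNIV \<subseteq> closure form_dom" using dense unfolding densely_defined_def by (simp only:)
  then have cl: "closure form_dom = UNIV" by (rule top.extremum_uniqueI)
  show ?thesis
    unfolding nonneg_selfadjoint_extension_def by (intro conjI selfadjoint_form_op[OF cl] extends)
qed

text \<open>Complete the square in \<open>norm (t + b)\<close>, where \<open>t\<close> is the image
  of the test vector under S. As S may be the root of any nonnegative selfadjoint extension, this is
  the source of minimality.\<close>

lemma form_le_if_sqrt:
  assumes S: "selfadjoint S" "V \<subseteq> S O S" and b: "(h, b) \<in> S" "(norm b)\<^sup>2 \<le> c"
  shows "form_le h c"
proof (rule form_leI)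
  fix f k assume "(f, k) \<in> V"
  then obtain t where t: "(f, t) \<in> S" "(t, k) \<in> S" using S(2) by blast
  have "Re (cinner f k) = (norm t)\<^sup>2" using selfadjointD(4)[OF S(1) t] by (simp add: cinner_self)
  moreover have "cinner k h = cinner t b" using selfadjointD(4)[OF S(1) t(2) b(1)] by simp
  moreover have "0 \<le> (norm (t + b))\<^sup>2" by simp
  ultimately show "0 \<le> Re (cinner f k) + 2 * Re (cinner k h) + c"
    using b(2) unfolding norm_add_sq by simp
qed

lemma form_le_iff_sqrt:
  "form_le h c \<longleftrightarrow> (\<exists>b. (h, b) \<in> sqrt_op form_op \<and> (norm b)\<^sup>2 \<le> c)"
proof
  note ext = nonneg_selfadjoint_extensionD[OF form_op_extension]
  note S = sqrt_op_props[OF ext(1,2)]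
  show "form_le h c" if "\<exists>b. (h, b) \<in> sqrt_op form_op \<and> (norm b)\<^sup>2 \<le> c"
    using that form_le_if_sqrt[OF S(1)] ext(3) S(3) by auto
  assume h: "form_le h c"
  note h' = form_leE[OF h]
  show "\<exists>b. (h, b) \<in> sqrt_op form_op \<and> (norm b)\<^sup>2 \<le> c"
  proof (rule form_domain_sqrt[OF S(1)], unfold S(3))
    fix f k assume fk: "(f, k) \<in> form_op"
    have "- h \<in> form_dom" "form (- h) = form h"
      using Q(5)[OF Q(1) h'(1)] scaleR[OF h'(1), of "-1"] by simp_all
    \<comment> \<open>The subgradient inequality at \<open>f\<close> with competitor
      \<open>- h\<close> extends the test from the graph of \<open>V\<close> to that of
      \<open>form_op\<close>, as \<open>form_domain_sqrt\<close> requires.\<close>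
    then have "form f + 2 * Re (cinner (- h - f) k) \<le> form h" using form_opE(4)[OF fk, of "- h"] by simp
    moreover have "form f = Re (cinner f k)" using form_opE(3)[OF fk] by simp
    ultimately show "0 \<le> Re (cinner f k) + 2 * Re (cinner k h) + c"
      using h'(2) Re_cinner_commute[of h k] by (simp add: cinner_diff_left)
  qed (use ext in auto)
qed

lemma op_le_extension:
  assumes "nonneg_selfadjoint_extension V B"
  shows "op_le form_op B"
proof -
  note B = nonneg_selfadjoint_extensionD[OF assms]
    and ext = nonneg_selfadjoint_extensionD(1,2)[OF form_op_extension]
  note SB = sqrt_op_props[OF B(1,2)] and S = sqrt_op_props[OF ext]
  have *: "\<exists>b. (f, b) \<in> sqrt_op form_op \<and> (norm b)\<^sup>2 \<le> (norm g)\<^sup>2" if "(f, g) \<in> sqrt_op B" for f g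
    using form_le_if_sqrt[OF SB(1) _ that order_refl] SB(3) B(3) form_le_iff_sqrt by simp
  have "norm (sqrt_op form_op \<cdot>\<^sub>o f) \<le> norm (sqrt_op B \<cdot>\<^sub>o f)" if f: "f \<in> Domain (sqrt_op B)" for f
  proof -
    obtain g where g: "(f, g) \<in> sqrt_op B" using f by blast
    obtain b where b: "(f, b) \<in> sqrt_op form_op" "(norm b)\<^sup>2 \<le> (norm g)\<^sup>2" using *[OF g] by blast
    have "norm b \<le> norm g" by (rule power2_le_imp_le[OF b(2)]) simp
    then show ?thesis
      using linear_opD(7)[OF selfadjointD(1)[OF S(1)] b(1)]
        linear_opD(7)[OF selfadjointD(1)[OF SB(1)] g] by simp
  qed
  moreover have "Domain (sqrt_op B) \<subseteq> Domain (sqrt_op form_op)"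
  proof
    fix f assume "f \<in> Domain (sqrt_op B)"
    then obtain g where "(f, g) \<in> sqrt_op B" by blast
    from *[OF this] show "f \<in> Domain (sqrt_op form_op)" by blast
  qed
  ultimately show ?thesis unfolding op_le_def by (intro conjI ballI)
qed

text \<open>Two smallest extensions lie below each other, so their roots have the same domain and
  the same norms, and \<open>form_determines\<close> identifies the operators.\<close>

lemma krein_extension_eq: "krein_extension V = form_op"
  unfolding krein_extension_def
proof (rule the_equality)
  show "nonneg_selfadjoint_extension V form_op \<and>
      (\<forall>B. nonneg_selfadjoint_extension V B \<longrightarrow> op_le form_op B)"
    using form_op_extension op_le_extension by simp
  fix K assume K: "nonneg_selfadjoint_extension V K \<and> (\<forall>B. nonneg_selfadjoint_extension V B \<longrightarrow> op_le K B)"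
  then have "nonneg_selfadjoint_extension V K" and le1: "op_le K form_op"
    using form_op_extension by simp_all
  note K' = nonneg_selfadjoint_extensionD(1,2)[OF this(1)] and le2 = op_le_extension[OF this(1)]
    and ext = nonneg_selfadjoint_extensionD(1,2)[OF form_op_extension]
  note SK = sqrt_op_props[OF K'] and S = sqrt_op_props[OF ext]
  have dom: "Domain (sqrt_op K) = Domain (sqrt_op form_op)" 
    using op_leD(1)[OF le1] op_leD(1)[OF le2] by (rule equalityI[rotated])
  have norm: "norm g = norm g'" if "(f, g) \<in> sqrt_op K" "(f, g') \<in> sqrt_op form_op" for f g g'
  proof -
    have "norm (sqrt_op K \<cdot>\<^sub>o f) = norm (sqrt_op form_op \<cdot>\<^sub>o f)"
      using op_leD(2)[OF le1 DomainI[OF that(2)]] op_leD(2)[OF le2 DomainI[OF that(1)]] by (rule antisym)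
    then show ?thesis
      using linear_opD(7)[OF selfadjointD(1)[OF SK(1)] that(1)]
        linear_opD(7)[OF selfadjointD(1)[OF S(1)] that(2)] by simp
  qed
  have "K \<subseteq> form_op" using form_determines[OF SK(1) S(1) dom norm] SK(3) S(3) by simp
  moreover have "form_op \<subseteq> K"
    using form_determines[OF S(1) SK(1) dom[symmetric] norm[symmetric]] SK(3) S(3) by simp
  ultimately show "K = form_op" by blast
qed

theorem sqrt_krein_extension_iff:
  "h \<in> Domain (sqrt_op (krein_extension V)) \<and> (norm (sqrt_op (krein_extension V) \<cdot>\<^sub>o h))\<^sup>2 \<le> c \<longleftrightarrow>
    (\<forall>(f, k)\<in>V. 0 \<le> Re (cinner f k) + 2 * Re (cinner k h) + c)"
proof -
  note ext = nonneg_selfadjoint_extensionD(1,2)[OF form_op_extension]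
  note app = linear_opD(7)[OF selfadjointD(1)[OF sqrt_op_props(1)[OF ext]]]
  show ?thesis
    unfolding krein_extension_eq form_le_def[symmetric] form_le_iff_sqrt
  proof
    assume h: "h \<in> Domain (sqrt_op form_op) \<and> (norm (sqrt_op form_op \<cdot>\<^sub>o h))\<^sup>2 \<le> c"
    then obtain b where b: "(h, b) \<in> sqrt_op form_op" by blast
    then show "\<exists>b. (h, b) \<in> sqrt_op form_op \<and> (norm b)\<^sup>2 \<le> c" using app[OF b] h by auto
  next
    assume "\<exists>b. (h, b) \<in> sqrt_op form_op \<and> (norm b)\<^sup>2 \<le> c"
    then obtain b where b: "(h, b) \<in> sqrt_op form_op" "(norm b)\<^sup>2 \<le> c" by blast
    then show "h \<in> Domain (sqrt_op form_op) \<and> (norm (sqrt_op form_op \<cdot>\<^sub>o h))\<^sup>2 \<le> c"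
      using app[OF b(1)] DomainI[OF b(1)] by simp
  qed
qed

end

section \<open>Proper dissipative extensions\<close>

lemma adjoint_closure: "adjoint_op (closure (T :: 'a::complex_inner lop)) = adjoint_op T"
proof
  show "adjoint_op (closure T) \<subseteq> adjoint_op T" by (rule adjoint_antimono[OF closure_subset])
  show "adjoint_op T \<subseteq> adjoint_op (closure T)"
  proof
    fix z assume "z \<in> adjoint_op T"
    then obtain g h where z: "z = (g, h)" "(g, h) \<in> adjoint_op T" by (cases z) auto
    have "(g, h) \<in> adjoint_op (closure T)"
    proof (rule adjointI)
      fix f k assume "(f, k) \<in> closure T"
      then obtain s where s: "\<And>n. s n \<in> T" "s \<longlonglongrightarrow> (f, k)" unfolding closure_sequential by blast
      have l1: "(\<lambda>n. cinner g (snd (s n))) \<longlonglongrightarrow> cinner g (snd (f, k))"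
        and l2: "(\<lambda>n. cinner h (fst (s n))) \<longlonglongrightarrow> cinner h (fst (f, k))"
        by (intro tendsto_intros s)+
      have "cinner g (snd (s n)) = cinner h (fst (s n))" for n
        using s(1)[of n] by (intro adjointD[OF z(2)]) simp
      then show "cinner g k = cinner h f" using LIMSEQ_unique[OF l1] l2 by simp
    qed
    then show "z \<in> adjoint_op (closure T)" using z(1) by simp
  qed
qed

lemma linear_op_closure_restrict:
  fixes A :: "'a::complex_inner lop"
  assumes A: "linear_op A" "closable A" and D: "csubspace D"
  shows "linear_op (closure (op_restrict A D))"
proof (rule linear_opI)
  note lin = linear_opD[OF A(1)] and D = csubspaceD[OF D]
  have "csubspace (op_restrict A D)"
    unfolding csubspace_def op_restrict_def
    using lin(1-3) D(1-3) by (auto simp: zero_prod_def scaleC_prod_def)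
  then show sub: "csubspace (closure (op_restrict A D))" by (rule csubspace_closure)
  fix g assume "(0, g) \<in> closure (op_restrict A D)"
  moreover have "(0, 0) \<in> closure (op_restrict A D)"
    using csubspaceD(1)[OF sub] by (simp add: zero_prod_def)
  moreover have "closure (op_restrict A D) \<subseteq> closure A"
    by (rule closure_mono) (auto simp: op_restrict_def)
  ultimately show "g = 0" using A(2) unfolding closable_def single_valued_def by blast
qed

text \<open>The vector \<open>v\<close> stays fixed while \<open>f\<close> varies, so the criterion
  concerns a single coset. Its right side is the defining condition of the form of
  \<open>V0\<close>, transported by \<open>key\<close> and closed up from the core to
  \<open>A'\<close>.\<close>

lemma dissipative_imaginary_part_sqrt_krein_iff:
  fixes A At A' :: "'a::chilbert_space lop"
  assumes pair: "linear_op A" "linear_op At" "A \<subseteq> adjoint_op At"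
    and diss: "\<And>f g. (f, g) \<in> A \<Longrightarrow> 0 \<le> Im (cinner f g)"
    and dense: "closure (Domain A \<inter> Domain At) = UNIV"
    and V0: "V0 = {(f, (1 / (2 * \<i>)) *\<^sub>C (g - h)) | f g h. (f, g) \<in> A \<and> (f, h) \<in> At}"
    and A': "A' = closure (op_restrict A (Domain A \<inter> Domain At))"
    and vw: "(v, w) \<in> adjoint_op (op_restrict At (Domain A \<inter> Domain At))"
  shows "v \<in> Domain (sqrt_op (krein_extension V0)) \<and>
      (norm (sqrt_op (krein_extension V0) \<cdot>\<^sub>o v))\<^sup>2 \<le> Im (cinner v w) \<longleftrightarrow>
    (\<forall>(f, g)\<in>A'. 0 \<le> Im (cinner (f + v) (g + w)))"
proof -
  note linA = linear_opD[OF pair(1)] and linAt = linear_opD[OF pair(2)]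
  let ?c = "1 / (2 * \<i>)"
  have cnj_c: "cnj ?c = - ?c" by (simp add: complex_eq_iff)
  have adj: "cinner f h = cinner g f'" if "(f, g) \<in> A" "(f', h) \<in> At" for f g f' h
    using pair(3) that by (intro adjointD[of f g At]) auto
  have adj': "cinner h f = cinner f' g" if "(f, g) \<in> A" "(f', h) \<in> At" for f g f' h
    using adj[OF that] by (metis cinner_commute)
  have V0I: "(f, ?c *\<^sub>C (g - h)) \<in> V0" if "(f, g) \<in> A" "(f, h) \<in> At" for f g h
    unfolding V0 using that by blast
  have V0E: "\<exists>g h. (f, g) \<in> A \<and> (f, h) \<in> At \<and> k = ?c *\<^sub>C (g - h)" if "(f, k) \<in> V0" for f k
    using that unfolding V0 by blast
  \<comment> \<open>The dual pair relation makes \<open>cinner f h\<close> the conjugate of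
    \<open>cinner f g\<close>; hence \<open>V0\<close> represents the imaginary part of
    \<open>A\<close> on the common domain.\<close>
  have V0_form: "cinner f (?c *\<^sub>C (g - h)) = of_real (Im (cinner f g))"
    if "(f, g) \<in> A" "(f, h) \<in> At" for f g h
  proof -
    have "cinner f h = cnj (cinner f g)" using adj[OF that] cinner_commute[of g f] by simp
    then have "cinner f (?c *\<^sub>C (g - h)) = ?c * (cinner f g - cnj (cinner f g))"
      by (simp only: cinner_scaleC_right cinner_diff_right)
    then show ?thesis by (simp add: complex_eq_iff)
  qed
  interpret nonneg_symmetric V0
  proof
    show "linear_op V0"
    proof (rule linear_opI)
      show "csubspace V0"
        unfolding csubspace_def
      proof (intro conjI ballI allI)
        show "0 \<in> V0" using V0I[OF linA(1) linAt(1)] by (simp add: zero_prod_def)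
        fix z assume "z \<in> V0"
        then obtain f g h where z: "z = (f, ?c *\<^sub>C (g - h))" "(f, g) \<in> A" "(f, h) \<in> At"
          unfolding V0 by blast
        show "c *\<^sub>C z \<in> V0" for c
          using V0I[OF linA(3)[OF z(2), of c] linAt(3)[OF z(3), of c]] unfolding z(1)
          by (simp add: scaleC_prod_def scaleC_diff_right[symmetric] scaleC_scaleC mult.commute)
        fix z' assume "z' \<in> V0"
        then obtain f' g' h' where z': "z' = (f', ?c *\<^sub>C (g' - h'))" "(f', g') \<in> A" "(f', h') \<in> At"
          unfolding V0 by blast
        show "z + z' \<in> V0"
          using V0I[OF linA(2)[OF z(2) z'(2)] linAt(2)[OF z(3) z'(3)]] unfolding z(1) z'(1)
          by (simp add: scaleC_add_right[symmetric] add_diff_add)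
      qed
      fix k assume "(0, k) \<in> V0"
      then obtain g h where gh: "(0, g) \<in> A" "(0, h) \<in> At" "k = ?c *\<^sub>C (g - h)" using V0E by blast
      show "k = 0" using linA(6)[OF linA(1) gh(1)] linAt(6)[OF linAt(1) gh(2)] gh(3) by simp
    qed
    have "Domain A \<inter> Domain At \<subseteq> Domain V0" using V0I by blast
    from closure_mono[OF this] show "densely_defined V0"
      unfolding densely_defined_def dense by (rule top.extremum_uniqueI)
    show "V0 \<subseteq> adjoint_op V0"
    proof
      fix z assume "z \<in> V0"
      then obtain f g h where z: "z = (f, ?c *\<^sub>C (g - h))" "(f, g) \<in> A" "(f, h) \<in> At"
        unfolding V0 by blast
      show "z \<in> adjoint_op V0"
        unfolding z(1)
      proof (rule adjointI)
        fix f' k' assume "(f', k') \<in> V0"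
        then obtain g' h' where z': "k' = ?c *\<^sub>C (g' - h')" "(f', g') \<in> A" "(f', h') \<in> At"
          using V0E by blast
        show "cinner f k' = cinner (?c *\<^sub>C (g - h)) f'"
          unfolding z'(1) cinner_scaleC_left cinner_scaleC_right cnj_c cinner_diff_left cinner_diff_right
            adj[OF z(2) z'(3)] adj'[OF z'(2) z(3)]
          by (simp only: mult_minus_left mult_minus_right[symmetric] minus_diff_eq)
      qed
    qed
    fix f k assume "(f, k) \<in> V0"
    then obtain g h where gh: "k = ?c *\<^sub>C (g - h)" "(f, g) \<in> A" "(f, h) \<in> At" using V0E by blast
    show "0 \<le> Re (cinner f k)" unfolding gh(1) V0_form[OF gh(2,3)] using diss[OF gh(2)] by simp
  qed
  \<comment> \<open>The adjoint relation replaces \<open>cinner f w\<close> by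
    \<open>cinner h v\<close>, so the cross terms involve only \<open>g - h\<close> paired with
    \<open>v\<close>.\<close>
  have key: "Im (cinner (f + v) (g + w)) =
      Re (cinner f (?c *\<^sub>C (g - h))) + 2 * Re (cinner (?c *\<^sub>C (g - h)) v) + Im (cinner v w)"
    if "(f, g) \<in> A" "(f, h) \<in> At" for f g h
  proof -
    have "(f, h) \<in> op_restrict At (Domain A \<inter> Domain At)"
      using that unfolding op_restrict_def by blast
    then have "cinner v h = cinner w f" by (rule adjointD[OF vw])
    then have "cinner f w = cinner h v" by (metis cinner_commute)
    then have "Im (cinner (f + v) (g + w)) =
        Im (cinner f g) + (Im (cinner h v) - Im (cinner g v)) + Im (cinner v w)"
      using Im_cinner_commute[of v g] by (simp add: cinner_add_left cinner_add_right)
    moreover have "2 * Re (cinner (?c *\<^sub>C (g - h)) v) = Im (cinner h v) - Im (cinner g v)"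
      unfolding cinner_scaleC_left cnj_c cinner_diff_left by simp
    ultimately show ?thesis using V0_form[OF that] by simp
  qed
  have "(\<forall>(f, k)\<in>V0. 0 \<le> Re (cinner f k) + 2 * Re (cinner k v) + Im (cinner v w)) \<longleftrightarrow>
      (\<forall>(f, g)\<in>A'. 0 \<le> Im (cinner (f + v) (g + w)))" (is "?L \<longleftrightarrow> ?R")
  proof
    assume L: ?L
    have core: "0 \<le> Im (cinner (fst z + v) (snd z + w))"
      if z: "z \<in> op_restrict A (Domain A \<inter> Domain At)" for z
    proof -
      obtain f g h where z': "z = (f, g)" "(f, g) \<in> A" "(f, h) \<in> At"
        using z unfolding op_restrict_def by blast
      show ?thesis using key[OF z'(2,3)] V0I[OF z'(2,3)] L z'(1) by auto
    qed
    show ?R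
    proof (intro ballI, clarify)
      fix f g assume "(f, g) \<in> A'"
      \<comment> \<open>The inequality passes from the core to the closure because the inner product
        is continuous along the graph.\<close>
      then obtain s where s: "\<And>n. s n \<in> op_restrict A (Domain A \<inter> Domain At)" "s \<longlonglongrightarrow> (f, g)"
        unfolding A' closure_sequential by blast
      have "(\<lambda>n. Im (cinner (fst (s n) + v) (snd (s n) + w))) \<longlonglongrightarrow>
          Im (cinner (fst (f, g) + v) (snd (f, g) + w))"
        by (intro tendsto_intros s)
      from LIMSEQ_le_const[OF this] show "0 \<le> Im (cinner (f + v) (g + w))" using core[OF s(1)] by simp
    qed
  next
    assume R: ?R
    show ?L
    proof (intro ballI, clarify)
      fix f k assume "(f, k) \<in> V0"
      then obtain g h where gh: "k = ?c *\<^sub>C (g - h)" "(f, g) \<in> A" "(f, h) \<in> At" using V0E by blast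
      then have "(f, g) \<in> op_restrict A (Domain A \<inter> Domain At)" unfolding op_restrict_def by blast
      then have "(f, g) \<in> A'" unfolding A' using closure_subset by (rule rev_subsetD)
      then have "0 \<le> Im (cinner (f + v) (g + w))" using R by blast
      then show "0 \<le> Re (cinner f k) + 2 * Re (cinner k v) + Im (cinner v w)"
        unfolding gh(1) key[OF gh(2,3)] .
    qed
  qed
  then show ?thesis unfolding sqrt_krein_extension_iff .
qed

text \<open>\<open>A\<close>, the adjoint of \<open>At\<close> and the candidate extension are all
  restrictions of the one operator \<open>T\<close> below. Inclusions between them are therefore
  inclusions of domains, which the last two conditions supply.\<close>

theorem corollary4p17:
  fixes A At A' At' V0' VK' :: "'a::chilbert_space lop" and \<W> \<V> :: "'a set"
  assumes "dual_pair A At"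
    and "dissipative A"
    and "closure (Domain A \<inter> Domain At) = UNIV"
    and "A' = closure (op_restrict A (Domain A \<inter> Domain At))"
    and "At' = closure (op_restrict At (Domain A \<inter> Domain At))"
    and "V0' = op_restrict (op_scale (1 / (2 * \<i>)) (op_diff A' At')) (Domain A \<inter> Domain At)"
    and "VK' = krein_extension V0'"
    and "complementary \<W> (Domain A') (Domain (adjoint_op At'))"
    and "csubspace \<V>" and "\<V> \<subseteq> \<W>"
  shows "proper_extension A At (extension_by A' At' \<V>) \<and> dissipative (extension_by A' At' \<V>) \<longleftrightarrow>
     \<V> \<subseteq> Domain (sqrt_op VK') \<and>
     (\<forall>v\<in>\<V>. (norm (sqrt_op VK' \<cdot>\<^sub>o v))\<^sup>2 \<le> Im (cinner v (adjoint_op At \<cdot>\<^sub>o v))) \<and>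
     Domain A \<subseteq> Domain (extension_by A' At' \<V>) \<and>
     \<V> \<subseteq> Domain (adjoint_op At)"
proof -
  define D where "D = Domain A \<inter> Domain At"
  have A: "linear_op A" "densely_defined A" "closable A"
    and At: "linear_op At" "densely_defined At" "closable At" and sub: "A \<subseteq> adjoint_op At"
    using assms(1) unfolding dual_pair_def by simp_all
  have A': "A' = closure (op_restrict A D)" and At': "At' = closure (op_restrict At D)"
    using assms(4,5) unfolding D_def .
  note linA = linear_opD[OF A(1)] and linAt = linear_opD[OF At(1)]
  have diss: "0 \<le> Im (cinner f g)" if "(f, g) \<in> A" for f g
    using assms(2) linA(7)[OF that] DomainI[OF that] unfolding dissipative_def by force
  have D: "csubspace D"
    unfolding D_def csubspace_def
    using csubspaceD(1-3)[OF csubspace_Domain[OF A(1)]] csubspaceD(1-3)[OF csubspace_Domain[OF At(1)]]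
    by simp
  have linA': "linear_op A'" and linAt': "linear_op At'"
    unfolding A' At' by (rule linear_op_closure_restrict[OF A(1,3) D] linear_op_closure_restrict[OF At(1,3) D])+
  have res: "op_restrict A D \<subseteq> A'" "op_restrict At D \<subseteq> At'"
    unfolding A' At' by (rule closure_subset)+
  have res': "op_restrict A D \<subseteq> A" "op_restrict At D \<subseteq> At" by (auto simp: op_restrict_def)
  define T where "T = adjoint_op At'"
  have T_eq: "T = adjoint_op (op_restrict At D)" unfolding T_def At' by (rule adjoint_closure)
  have At_T: "adjoint_op At \<subseteq> T" unfolding T_eq by (rule adjoint_antimono[OF res'(2)])
  \<comment> \<open>The adjoint is closed, so it contains the closure of every restriction of
    \<open>A\<close>.\<close>
  have A'_At: "A' \<subseteq> adjoint_op At"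
    unfolding A' using res'(1) sub by (intro closure_minimal closed_adjoint) (rule order_trans)
  have "D \<subseteq> Domain (op_restrict At D)" unfolding D_def op_restrict_def by blast
  from closure_mono[OF this] have "densely_defined (op_restrict At D)"
    using assms(3) unfolding densely_defined_def D_def[symmetric] by (simp add: top.extremum_unique)
  then have "linear_op T" unfolding T_eq by (rule linear_op_adjoint)
  note linT = linear_opD[OF \<open>linear_op T\<close>] and linAts = linear_opD[OF linear_op_adjoint[OF At(2)]]
  \<comment> \<open>On the common domain the closures take the same values as \<open>A\<close> and
    \<open>At\<close>, since they are single-valued and contain the restrictions.\<close>
  have V0': "V0' = {(f, (1 / (2 * \<i>)) *\<^sub>C (g - h)) | f g h. (f, g) \<in> A \<and> (f, h) \<in> At}"
  proof -
    have eqA: "(f, g) \<in> A' \<longleftrightarrow> (f, g) \<in> A" if fD: "f \<in> D" for f g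
    proof -
      obtain g' where g': "(f, g') \<in> A" using fD unfolding D_def by blast
      then have "(f, g') \<in> A'" using fD g' res(1) unfolding op_restrict_def by blast
      then show ?thesis using g' linA(6) linear_opD(6)[OF linA'] by metis
    qed
    have eqAt: "(f, g) \<in> At' \<longleftrightarrow> (f, g) \<in> At" if fD: "f \<in> D" for f g
    proof -
      obtain g' where g': "(f, g') \<in> At" using fD unfolding D_def by blast
      then have "(f, g') \<in> At'" using fD g' res(2) unfolding op_restrict_def by blast
      then show ?thesis using g' linAt(6) linear_opD(6)[OF linAt'] by metis
    qed
    show ?thesis
    proof (intro equalityI subsetI)
      fix z assume "z \<in> V0'"
      then obtain f g h where z: "z = (f, (1 / (2 * \<i>)) *\<^sub>C (g - h))" "f \<in> D" "(f, g) \<in> A'" "(f, h) \<in> At'"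
        unfolding assms(6) op_restrict_def op_scale_def op_diff_def D_def[symmetric] by blast
      then show "z \<in> {(f, (1 / (2 * \<i>)) *\<^sub>C (g - h)) | f g h. (f, g) \<in> A \<and> (f, h) \<in> At}"
        using eqA eqAt by blast
    next
      fix z assume "z \<in> {(f, (1 / (2 * \<i>)) *\<^sub>C (g - h)) | f g h. (f, g) \<in> A \<and> (f, h) \<in> At}"
      then obtain f g h where z: "z = (f, (1 / (2 * \<i>)) *\<^sub>C (g - h))" "(f, g) \<in> A" "(f, h) \<in> At" by blast
      have f: "f \<in> D" unfolding D_def using z(2,3) by blast
      have "(f, g - h) \<in> op_diff A' At'"
        unfolding op_diff_def using z(2,3) eqA[OF f] eqAt[OF f] by blast
      then have "z \<in> op_scale (1 / (2 * \<i>)) (op_diff A' At')" unfolding op_scale_def z(1) by blast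
      then show "z \<in> V0'" unfolding assms(6) op_restrict_def D_def[symmetric] using f z(1) by simp
    qed
  qed
  have crit: "v \<in> Domain (sqrt_op VK') \<and> (norm (sqrt_op VK' \<cdot>\<^sub>o v))\<^sup>2 \<le> Im (cinner v w) \<longleftrightarrow>
      (\<forall>(f, g)\<in>A'. 0 \<le> Im (cinner (f + v) (g + w)))" if "(v, w) \<in> T" for v w
    unfolding assms(7)
    by (rule dissipative_imaginary_part_sqrt_krein_iff[OF A(1) At(1) sub diss assms(3) V0' assms(4)])
      (use that in \<open>simp_all add: T_eq D_def\<close>)
  define C where "C = extension_by A' At' \<V>"
  define M where "M = {f + v | f v. f \<in> Domain A' \<and> v \<in> \<V>}"
  have C_iff: "(x, y) \<in> C \<longleftrightarrow> (x, y) \<in> T \<and> x \<in> M" for x y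
    unfolding C_def extension_by_def op_restrict_def T_def M_def by simp
  note V = csubspaceD[OF assms(9)] and DA' = csubspaceD[OF csubspace_Domain[OF linA']]
  have "\<W> \<subseteq> Domain T"
    using assms(8) unfolding complementary_def T_def by (elim conjE)
  with assms(10) have V_T: "\<V> \<subseteq> Domain T" by (rule order_trans)
  have V_M: "\<V> \<subseteq> M"
  proof
    fix v assume "v \<in> \<V>"
    then have "0 + v \<in> M" unfolding M_def using DA'(1) by blast
    then show "v \<in> M" by simp
  qed
  have C_I: "(f + v, g + w) \<in> C" if "(f, g) \<in> A'" "v \<in> \<V>" "(v, w) \<in> T" for f g v w
    unfolding C_iff
  proof
    have "(f, g) \<in> T" using that(1) A'_At At_T by blast
    then show "(f + v, g + w) \<in> T" by (rule linT(2)[OF _ that(3)])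
    show "f + v \<in> M" unfolding M_def using that by blast
  qed
  \<comment> \<open>Conversely to \<open>C_I\<close>, single-valuedness of \<open>T\<close> forces
    the value at \<open>f + v\<close> to split accordingly.\<close>
  have C_E: "\<exists>f g v w. (f, g) \<in> A' \<and> v \<in> \<V> \<and> (v, w) \<in> T \<and> x = f + v \<and> y = g + w" if xy: "(x, y) \<in> C" for x y
  proof -
    obtain f v where fv: "f \<in> Domain A'" "v \<in> \<V>" "x = f + v" using xy unfolding C_iff M_def by blast
    obtain g where g: "(f, g) \<in> A'" using fv(1) by blast
    obtain w where w: "(v, w) \<in> T" using fv(2) V_T by blast
    have "(x, g + w) \<in> T" using C_I[OF g fv(2) w] unfolding C_iff fv(3) by simp
    moreover have "(x, y) \<in> T" using xy unfolding C_iff by simp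
    ultimately have "y = g + w" using linT(6) by blast
    then show ?thesis using g fv w by blast
  qed
  have "csubspace M"
    unfolding csubspace_def
  proof (intro conjI ballI allI)
    show "0 \<in> M" using V_M V(1) by blast
    fix x assume "x \<in> M"
    then obtain f v where x: "f \<in> Domain A'" "v \<in> \<V>" "x = f + v" unfolding M_def by blast
    show "c *\<^sub>C x \<in> M" for c
      unfolding x(3) scaleC_add_right M_def using DA'(3)[OF x(1)] V(3)[OF x(2)] by blast
    fix y assume "y \<in> M"
    then obtain f' v' where y: "f' \<in> Domain A'" "v' \<in> \<V>" "y = f' + v'" unfolding M_def by blast
    have "(f + f') + (v + v') \<in> M" unfolding M_def using DA'(2)[OF x(1) y(1)] V(2)[OF x(2) y(2)] by blast
    then show "x + y \<in> M" unfolding x(3) y(3) by (simp add: algebra_simps)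
  qed
  note M = csubspaceD[OF this]
  have linC: "linear_op C"
  proof (rule linear_opI)
    show "csubspace C"
      unfolding csubspace_def
      by (auto simp: zero_prod_def scaleC_prod_def C_iff intro: linT(1-3) M(1-3))
    show "g = 0" if "(0, g) \<in> C" for g using that linT(6)[OF linT(1), of g] unfolding C_iff by simp
  qed
  note linC' = linear_opD[OF linC]
  show ?thesis
    unfolding C_def[symmetric]
  proof
    assume L: "proper_extension A At C \<and> dissipative C"
    then have AC: "A \<subseteq> C" and CAt: "C \<subseteq> adjoint_op At" unfolding proper_extension_def by simp_all
    have pos: "0 \<le> Im (cinner x y)" if "(x, y) \<in> C" for x y
      using L linC'(7)[OF that] DomainI[OF that] unfolding dissipative_def by force
    have "v \<in> Domain (adjoint_op At) \<and> v \<in> Domain (sqrt_op VK') \<and>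
        (norm (sqrt_op VK' \<cdot>\<^sub>o v))\<^sup>2 \<le> Im (cinner v (adjoint_op At \<cdot>\<^sub>o v))" if v: "v \<in> \<V>" for v
    proof -
      obtain w where w: "(v, w) \<in> T" using v V_T by blast
      then have "(v, w) \<in> C" using v V_M unfolding C_iff by blast
      then have w': "(v, w) \<in> adjoint_op At" using CAt by blast
      \<comment> \<open>The whole coset of \<open>v\<close> lies in the domain of \<open>C\<close>,
        so dissipativity supplies exactly the right side of \<open>crit\<close>.\<close>
      have "\<forall>(f, g)\<in>A'. 0 \<le> Im (cinner (f + v) (g + w))" using pos[OF C_I[OF _ v w]] by blast
      then have "v \<in> Domain (sqrt_op VK') \<and> (norm (sqrt_op VK' \<cdot>\<^sub>o v))\<^sup>2 \<le> Im (cinner v w)"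
        unfolding crit[OF w] .
      then show ?thesis using linAts(7)[OF w'] DomainI[OF w'] by simp
    qed
    moreover have "Domain A \<subseteq> Domain C" using AC by (rule Domain_mono)
    ultimately show "\<V> \<subseteq> Domain (sqrt_op VK') \<and>
       (\<forall>v\<in>\<V>. (norm (sqrt_op VK' \<cdot>\<^sub>o v))\<^sup>2 \<le> Im (cinner v (adjoint_op At \<cdot>\<^sub>o v))) \<and>
       Domain A \<subseteq> Domain C \<and> \<V> \<subseteq> Domain (adjoint_op At)" by (simp add: subset_iff)
  next
    assume R: "\<V> \<subseteq> Domain (sqrt_op VK') \<and>
       (\<forall>v\<in>\<V>. (norm (sqrt_op VK' \<cdot>\<^sub>o v))\<^sup>2 \<le> Im (cinner v (adjoint_op At \<cdot>\<^sub>o v))) \<and>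
       Domain A \<subseteq> Domain C \<and> \<V> \<subseteq> Domain (adjoint_op At)"
    \<comment> \<open>The value of \<open>T\<close> at \<open>v\<close> is the value of the smaller
      adjoint, because \<open>v\<close> already lies in the domain of that restriction.\<close>
    have V_At: "(v, w) \<in> adjoint_op At" if v: "v \<in> \<V>" and w: "(v, w) \<in> T" for v w
    proof -
      obtain w' where w': "(v, w') \<in> adjoint_op At" using R v by blast
      then have "(v, w') \<in> T" using At_T by blast
      then show ?thesis using linT(6)[OF w] w' by simp
    qed
    have "A \<subseteq> C"
    proof
      fix z assume "z \<in> A"
      then obtain f g where z: "z = (f, g)" "(f, g) \<in> A" by (cases z) auto
      have "f \<in> Domain C" using R DomainI[OF z(2)] by blast
      then have "f \<in> M" using C_iff by blast
      moreover have "(f, g) \<in> T" using z(2) sub At_T by blast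
      ultimately show "z \<in> C" unfolding z(1) C_iff by simp
    qed
    moreover have "C \<subseteq> adjoint_op At"
    proof
      fix z assume "z \<in> C"
      then obtain x y where z: "z = (x, y)" "(x, y) \<in> C" by (cases z) auto
      obtain f g v w where fg: "(f, g) \<in> A'" "v \<in> \<V>" "(v, w) \<in> T" "x = f + v" "y = g + w"
        using C_E[OF z(2)] by blast
      have "(f, g) \<in> adjoint_op At" using fg(1) A'_At by blast
      from linAts(2)[OF this V_At[OF fg(2,3)]] show "z \<in> adjoint_op At" unfolding z(1) fg(4,5) .
    qed
    moreover have "densely_defined C"
    proof -
      have "closure (Domain A) \<subseteq> closure (Domain C)" using R by (intro closure_mono) simp
      then show ?thesis using A(2) unfolding densely_defined_def by (simp add: top.extremum_unique)
    qed
    moreover have "0 \<le> Im (cinner x (C \<cdot>\<^sub>o x))" if x: "x \<in> Domain C" for x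
    proof -
      obtain y where y: "(x, y) \<in> C" using x by blast
      obtain f g v w where fg: "(f, g) \<in> A'" "v \<in> \<V>" "(v, w) \<in> T" "x = f + v" "y = g + w"
        using C_E[OF y] by blast
      have "v \<in> Domain (sqrt_op VK') \<and> (norm (sqrt_op VK' \<cdot>\<^sub>o v))\<^sup>2 \<le> Im (cinner v w)"
        using R fg(2) linAts(7)[OF V_At[OF fg(2,3)]] by auto
      then have "\<forall>(f, g)\<in>A'. 0 \<le> Im (cinner (f + v) (g + w))" unfolding crit[OF fg(3)] .
      then have "0 \<le> Im (cinner x y)" using fg(1) unfolding fg(4,5) by blast
      then show ?thesis using linC'(7)[OF y] by simp
    qed
    ultimately show "proper_extension A At C \<and> dissipative C"
      unfolding proper_extension_def dissipative_def using linC by simp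
  qed
qed

end
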